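(* Let $A$ be an $N \times M$ complex or real matrix and let $Z$ be its best rank-$r$ approximation in the spectral and Frobenius norms. Let $\widetilde{A}$ be a rectangular CGR-approximant of $A$ (see context), based on $n$ rows ($r \le n \ll N$) and $m$ columns ($r \le m \ll M$), with the basis rows and basis columns selected as dominant submatrices (see context). Then $$\Vert A - \widetilde{A} \Vert_C < 2 \sqrt{\frac{(n+1)(m+1)}{(n+1-r)(m+1-r)}}\; \sigma_{r+1}(A).$$
   Context: $\Vert X \Vert_C = \max_{i,j}|X_{ij}|$ is the Chebyshev norm, $X^\dagger$ is the Moore–Penrose pseudo-inverse, and $\sigma_i$ is the $i$-th largest singular value. For a matrix $X \in \mathbb{C}^{k \times q}$ with $k \ge q$, its (rectangular) volume is $\mathrm{vol}(X) = \sqrt{\det(X^*X)}$. For a $p \times q$ matrix $B$ of full column rank and $p \ge k \ge q$, a $k \times q$ submatrix $\widehat{B}$ of $B$ (formed by $k$ rows of $B$) is called dominant if a swap of any single row of $\widehat{B}$ for a row of $B$ not already present in $\widehat{B}$ does not increase the volume. Basis rows: for a $p \times q$ matrix $B$ of full column rank, given $k \ge q$ rows are called basis rows if any other row of $B$ can be written as a linear combination of the given ones. Selecting the basis rows as a dominant submatrix means that the submatrix $\widehat{B} \in \mathbb{C}^{k \times q}$ on these rows is a dominant submatrix of $B$, with the minimum norm solution $T$ of $T\widehat{B} = B$ satisfying $\Vert T_i \Vert_2 \le \sqrt{q/(k+1-q)}$ for each row $T_i$ corresponding to a non-basis row. Basis columns of a matrix of full row rank, and their selection as a dominant submatrix,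 are defined analogously by transposition. Rectangular CGR-approximant of $A$ based on $n$ rows and $m$ columns: factorize $Z = Z_U Z_V$ with $Z_U \in \mathbb{C}^{N \times r}$ and $Z_V \in \mathbb{C}^{r \times M}$; select $n$ basis rows of $Z_U$; let $R \in \mathbb{C}^{n \times M}$ be the submatrix of $A$ on the corresponding rows; compute a singular value decomposition of $R$ and truncate singular values and vectors starting from the $(r+1)$-th, so that $R = USV + E$, where $USV$ is the main part ($U \in \mathbb{C}^{n \times r}$ has the $r$ leading left singular vectors as columns, $S$ is the $r \times r$ diagonal matrix of the $r$ leading singular values of $R$, $V \in \mathbb{C}^{r \times M}$ has the $r$ leading right singular vectors as rows) and $E$ is the truncated part; select $m$ basis columns of $V$ and let $W \in \mathbb{C}^{r \times m}$ be the corresponding submatrix of $V$; let $C \in \mathbb{C}^{N \times m}$ be the submatrix of $A$ on the corresponding columns. The approximant is $\widetilde{A} = C\,(USW)^\dagger R$.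
   Formalization: The strict inequality is asserted only when σ_{r+1}(A) > 0, since for σ_{r+1}(A) = 0 it would read 0 < 0 and fail; in general the bound is proved with ≤. *)

theory Defs
  imports
    Complex_Main
    "Jordan_Normal_Form.Char_Poly"
    "Jordan_Normal_Form.Schur_Decomposition"
    "Jordan_Normal_Form.DL_Rank"
    "Jordan_Normal_Form.DL_Submatrix"
begin

subsection \<open>Norms, singular values, pseudo-inverse\<close>

definition l2_norm_vec :: "complex vec \<Rightarrow> real" where
  "l2_norm_vec v = sqrt (\<Sum>i<dim_vec v. (cmod (v $ i))\<^sup>2)"

text \<open>Only meaningful for matrices with at least one row and one column.\<close>
definition chebyshev_norm :: "complex mat \<Rightarrow> real" where
  "chebyshev_norm X = Max {cmod (X $$ (i, j)) | i j. i < dim_row X \<and> j < dim_col X}"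

definition frobenius_norm :: "complex mat \<Rightarrow> real" where
  "frobenius_norm X = sqrt (\<Sum>i<dim_row X. \<Sum>j<dim_col X. (cmod (X $$ (i, j)))\<^sup>2)"

definition spectral_norm :: "complex mat \<Rightarrow> real" where
  "spectral_norm X = Sup {l2_norm_vec (X *\<^sub>v v) | v. v \<in> carrier_vec (dim_col X) \<and> l2_norm_vec v \<le> 1}"

text \<open>The singular values of \<open>X\<close> are the square roots of the eigenvalues of \<open>X\<^sup>* X\<close>, counted
  with algebraic multiplicity; these eigenvalues are real and nonnegative, so taking the real part
  loses nothing. There are \<open>dim_col X\<close> of them, and the index \<open>k\<close> is 1-based, so
  \<open>singular_value X k\<close> is meaningful for \<open>1 \<le> k \<le> dim_col X\<close>.\<close>
definition singular_value :: "complex mat \<Rightarrow> nat \<Rightarrow> real" where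
  "singular_value X k =
     rev (sorted_list_of_multiset
            (image_mset (\<lambda>z. sqrt (Re z)) (proots (char_poly (mat_adjoint X * X))))) ! (k - 1)"

abbreviation mat_rank :: "complex mat \<Rightarrow> nat" where
  "mat_rank X \<equiv> vec_space.rank (dim_row X) X"

definition is_pseudo_inverse :: "complex mat \<Rightarrow> complex mat \<Rightarrow> bool" where
  "is_pseudo_inverse X Y \<longleftrightarrow>
     Y \<in> carrier_mat (dim_col X) (dim_row X) \<and>
     X * Y * X = X \<and> Y * X * Y = Y \<and>
     mat_adjoint (X * Y) = X * Y \<and> mat_adjoint (Y * X) = Y * X"

definition pseudo_inverse :: "complex mat \<Rightarrow> complex mat" where
  "pseudo_inverse X = (THE Y. is_pseudo_inverse X Y)"

definition unitary_mat :: "nat \<Rightarrow> complex mat \<Rightarrow> bool" where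
  "unitary_mat k P \<longleftrightarrow>
     P \<in> carrier_mat k k \<and> mat_adjoint P * P = 1\<^sub>m k \<and> P * mat_adjoint P = 1\<^sub>m k"

text \<open>The \<open>p \<times> q\<close> (rectangular) diagonal matrix of the leading singular values of \<open>X\<close>.\<close>
definition singular_value_mat :: "nat \<Rightarrow> nat \<Rightarrow> complex mat \<Rightarrow> complex mat" where
  "singular_value_mat p q X =
     mat p q (\<lambda>(i, j). if i = j then complex_of_real (singular_value X (i + 1)) else 0)"

text \<open>Full singular value decomposition \<open>X = P D Q\<close>: the columns of \<open>P\<close> are the left singular
  vectors, and the rows of \<open>Q\<close> are the (conjugated) right singular vectors.\<close>
definition is_svd :: "complex mat \<Rightarrow> complex mat \<Rightarrow> complex mat \<Rightarrow> bool" where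
  "is_svd X P Q \<longleftrightarrow>
     unitary_mat (dim_row X) P \<and> unitary_mat (dim_col X) Q \<and>
     X = P * singular_value_mat (dim_row X) (dim_col X) X * Q"

text \<open>The set \<open>K\<close> of admissible matrix entries is used with \<open>UNIV\<close> (complex matrices) and
  with \<open>\<real>\<close> (real matrices).\<close>
definition best_rank_approx :: "complex set \<Rightarrow> nat \<Rightarrow> complex mat \<Rightarrow> complex mat \<Rightarrow> bool" where
  "best_rank_approx K r A Z \<longleftrightarrow>
     Z \<in> carrier_mat (dim_row A) (dim_col A) \<and> elements_mat Z \<subseteq> K \<and> mat_rank Z \<le> r \<and>
     (\<forall>Y \<in> carrier_mat (dim_row A) (dim_col A). elements_mat Y \<subseteq> K \<and> mat_rank Y \<le> r \<longrightarrow>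
        spectral_norm (A - Z) \<le> spectral_norm (A - Y) \<and>
        frobenius_norm (A - Z) \<le> frobenius_norm (A - Y))"

subsection \<open>Volume and dominant submatrices\<close>

text \<open>The determinant of a Gram matrix is real and nonnegative.\<close>
definition volume :: "complex mat \<Rightarrow> real" where
  "volume X = sqrt (Re (det (mat_adjoint X * X)))"

text \<open>A choice of \<open>k\<close> rows is a set \<open>I\<close> of (0-based) row indices; the submatrix keeps the rows in
  increasing order of index, which affects neither the volume nor the approximant below.\<close>
definition rows_submatrix :: "complex mat \<Rightarrow> nat set \<Rightarrow> complex mat" where
  "rows_submatrix B I = submatrix B I UNIV"

definition cols_submatrix :: "complex mat \<Rightarrow> nat set \<Rightarrow> complex mat" where
  "cols_submatrix B J = submatrix B UNIV J"

definition dominant_rows :: "complex mat \<Rightarrow> nat set \<Rightarrow> bool" where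
  "dominant_rows B I \<longleftrightarrow>
     (\<forall>i \<in> I. \<forall>j \<in> {..<dim_row B} - I.
        volume (rows_submatrix B (insert j (I - {i}))) \<le> volume (rows_submatrix B I))"

definition basis_rows :: "complex mat \<Rightarrow> nat set \<Rightarrow> bool" where
  "basis_rows B I \<longleftrightarrow>
     (\<forall>j \<in> {..<dim_row B} - I. \<exists>c. \<forall>l < dim_col B.
        B $$ (j, l) = (\<Sum>i\<in>I. c i * B $$ (i, l)))"

definition min_norm_solution :: "complex mat \<Rightarrow> complex mat \<Rightarrow> complex mat \<Rightarrow> bool" where
  "min_norm_solution X B T \<longleftrightarrow>
     T \<in> carrier_mat (dim_row B) (dim_row X) \<and> T * X = B \<and>
     (\<forall>T' \<in> carrier_mat (dim_row B) (dim_row X).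
        T' * X = B \<longrightarrow> frobenius_norm T \<le> frobenius_norm T')"

definition dominant_basis_rows :: "complex mat \<Rightarrow> nat \<Rightarrow> nat set \<Rightarrow> bool" where
  "dominant_basis_rows B k I \<longleftrightarrow>
     dim_col B \<le> k \<and> mat_rank B = dim_col B \<and>
     I \<subseteq> {..<dim_row B} \<and> card I = k \<and>
     basis_rows B I \<and> dominant_rows B I \<and>
     (\<exists>T. min_norm_solution (rows_submatrix B I) B T \<and>
        (\<forall>i \<in> {..<dim_row B} - I.
           l2_norm_vec (row T i) \<le> sqrt (real (dim_col B) / (real k + 1 - real (dim_col B)))))"

definition dominant_basis_cols :: "complex mat \<Rightarrow> nat \<Rightarrow> nat set \<Rightarrow> bool" where
  "dominant_basis_cols B k J \<longleftrightarrow> dominant_basis_rows (transpose_mat B) k J"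

subsection \<open>Rectangular CGR-approximants\<close>

text \<open>\<open>At\<close> is a rectangular CGR-approximant of \<open>A\<close>, built from the rank-\<open>r\<close> matrix \<open>Z\<close>, on
  \<open>n\<close> rows (index set \<open>I\<close>) and \<open>m\<close> columns (index set \<open>J\<close>), both selected as dominant.\<close>
definition dominant_cgr_approximant ::
  "nat \<Rightarrow> nat \<Rightarrow> nat \<Rightarrow> complex mat \<Rightarrow> complex mat \<Rightarrow> complex mat \<Rightarrow> bool" where
  "dominant_cgr_approximant r n m A Z At \<longleftrightarrow>
     (\<exists>ZU ZV I R P Q U S V J W C.
        ZU \<in> carrier_mat (dim_row A) r \<and> ZV \<in> carrier_mat r (dim_col A) \<and> Z = ZU * ZV \<and>
        dominant_basis_rows ZU n I \<and>
        R = rows_submatrix A I \<and>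
        is_svd R P Q \<and>
        U = cols_submatrix P {..<r} \<and>
        S = singular_value_mat r r R \<and>
        V = rows_submatrix Q {..<r} \<and>
        dominant_basis_cols V m J \<and>
        W = cols_submatrix V J \<and>
        C = cols_submatrix A J \<and>
        At = C * pseudo_inverse (U * S * W) * R)"

end

theory Submission
  imports Defs "HOL-Analysis.L2_Norm"
begin

text \<open>
  Write \<open>B = U S W\<close>, \<open>X = B\<^sup>\<dagger>\<close>, \<open>G = X R\<close> and \<open>E = R - U S V\<close>. Let \<open>T\<close> interpolate the rows of \<open>Z\<^sub>U\<close> from the
  basis rows, and let \<open>L\<close>, \<open>H\<close> be the selections with \<open>R = L A\<close>, \<open>C = A H\<close>. Since \<open>B G = U S V\<close> and
  \<open>(1 - T L) Z = 0\<close>,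
  \[ A - C X R = T E (1 - H G) + (1 - T L) (A - Z) (1 - H G). \]
  Both \<open>A - Z\<close> and \<open>E\<close> have operator norm at most \<open>\<sigma>\<^sub>r\<^sub>+\<^sub>1(A)\<close>, the latter because \<open>L Z\<close> is a competitor of rank
  \<open>r\<close> for \<open>R\<close>. The columns of \<open>G\<close> are orthogonal projections of those of a dominant interpolation
  matrix, so by Pythagoras the columns of \<open>1 - H G\<close> and the rows of \<open>1 - T L\<close> have norms at most
  \<open>\<surd>((m+1)/(m+1-r))\<close> and \<open>\<surd>((n+1)/(n+1-r))\<close>, while a row of \<open>T\<close> has norm at most \<open>\<surd>(r/(n+1-r))\<close>, or it
  is a unit vector and the matching row of \<open>1 - T L\<close> vanishes.

  That \<open>\<parallel>A - Z\<parallel>\<^sub>2 \<le> \<sigma>\<^sub>r\<^sub>+\<^sub>1(A)\<close> needs a truncated singular value decomposition with entries in \<open>K\<close>; this is why the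
  diagonalization of \<open>A\<^sup>* A\<close> keeps track of the scalars.
\<close>

section \<open>Adjoints and Euclidean norms\<close>

lemma mat_adjoint_eq: "mat_adjoint A = mat (dim_col A) (dim_row A) (\<lambda>(i, j). cnj (A $$ (j, i)))"
  unfolding mat_adjoint_def by (rule eq_matI) (auto simp: mat_of_rows_def)

lemma dim_mat_adjoint [simp]:
  "dim_row (mat_adjoint A) = dim_col (A :: complex mat)"
  "dim_col (mat_adjoint A) = dim_row (A :: complex mat)"
  by (simp_all add: mat_adjoint_eq)

lemma mat_adjoint_carrier [simp]:
  "(A :: complex mat) \<in> carrier_mat n m \<Longrightarrow> mat_adjoint A \<in> carrier_mat m n"
  by (simp add: mat_adjoint_eq)

lemma index_mat_adjoint [simp]:
  "i < dim_col A \<Longrightarrow> j < dim_row A \<Longrightarrow> mat_adjoint A $$ (i, j) = cnj (A $$ (j, i))"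
  by (simp add: mat_adjoint_eq)

lemma mat_adjoint_adjoint [simp]: "mat_adjoint (mat_adjoint A) = (A :: complex mat)"
  by (rule eq_matI) auto

lemma mat_adjoint_one [simp]: "mat_adjoint (1\<^sub>m n :: complex mat) = 1\<^sub>m n"
  by (rule eq_matI) auto

lemma mult_mat_assoc:
  assumes "dim_col A = dim_row B" "dim_col B = dim_row C"
  shows "(A * B) * C = A * (B * (C :: 'a :: semiring_0 mat))"
  using assms by (intro assoc_mult_mat) auto

lemma mult_mat_vec_assoc:
  assumes "dim_col A = dim_row B" "dim_col B = dim_vec v"
  shows "(A * B) *\<^sub>v v = A *\<^sub>v (B *\<^sub>v (v :: 'a :: semiring_0 vec))"
  using assms by (intro assoc_mult_mat_vec) auto

lemma mat_adjoint_mult: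
  assumes "dim_col (A :: complex mat) = dim_row B"
  shows "mat_adjoint (A * B) = mat_adjoint B * mat_adjoint A"
  by (rule eq_matI) (use assms in \<open>auto simp: scalar_prod_def mult.commute\<close>)

lemma mat_adjoint_mat_diag [simp]: "mat_adjoint (mat_diag n f) = mat_diag n (\<lambda>i. cnj (f i))"
  by (rule eq_matI) (auto simp: mat_diag_def)

section \<open>Euclidean norm, inner product and isometries\<close>

lemma l2_norm_vec_L2_set: "l2_norm_vec v = L2_set (\<lambda>i. cmod (v $ i)) {..<dim_vec v}"
  by (simp add: l2_norm_vec_def L2_set_def)

lemma l2_norm_vec_nonneg [simp]: "0 \<le> l2_norm_vec v"
  by (simp add: l2_norm_vec_def sum_nonneg)

lemma l2_norm_vec_power2: "(l2_norm_vec v)\<^sup>2 = (\<Sum>i<dim_vec v. (cmod (v $ i))\<^sup>2)"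
  by (simp add: l2_norm_vec_def sum_nonneg)

text \<open>Norm identities below are proved for the complex sesquilinear form and carried back to
  the reals by injectivity of \<open>complex_of_real\<close>.\<close>

lemma of_real_l2_norm_vec_power2: "complex_of_real ((l2_norm_vec v)\<^sup>2) = v \<bullet>c v"
  by (simp add: l2_norm_vec_power2 scalar_prod_def lessThan_atLeast0 complex_norm_square del: of_real_power)

lemma l2_norm_vec_eq_0_iff: "l2_norm_vec v = 0 \<longleftrightarrow> v = 0\<^sub>v (dim_vec v)"
  by (auto simp: l2_norm_vec_def sum_nonneg_eq_0_iff intro!: eq_vecI) (metis index_zero_vec(1))

lemma l2_norm_vec_smult: "l2_norm_vec (a \<cdot>\<^sub>v v) = cmod a * l2_norm_vec v"
  by (simp add: l2_norm_vec_def norm_mult power_mult_distrib real_sqrt_mult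
      flip: sum_distrib_left)

lemma cmod_scalar_prod_le:
  assumes "dim_vec u = dim_vec v"
  shows "cmod (u \<bullet> v) \<le> l2_norm_vec u * l2_norm_vec v"
proof -
  have "cmod (u \<bullet> v) \<le> (\<Sum>i<dim_vec v. \<bar>cmod (u $ i)\<bar> * \<bar>cmod (v $ i)\<bar>)"
    unfolding scalar_prod_def lessThan_atLeast0
    by (rule order_trans[OF norm_sum]) (simp add: norm_mult)
  also have "\<dots> \<le> l2_norm_vec u * l2_norm_vec v"
    unfolding l2_norm_vec_L2_set assms by (rule L2_set_mult_ineq)
  finally show ?thesis .
qed

lemma cscalar_prod_adjoint:
  fixes A :: "complex mat"
  assumes "A \<in> carrier_mat n m" "x \<in> carrier_vec m" "y \<in> carrier_vec n"
  shows "(A *\<^sub>v x) \<bullet>c y = x \<bullet>c (mat_adjoint A *\<^sub>v y)"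
proof -
  have "(A *\<^sub>v x) \<bullet>c y = (\<Sum>i<n. \<Sum>j<m. A $$ (i, j) * x $ j * cnj (y $ i))"
    using assms by (simp add: scalar_prod_def lessThan_atLeast0 sum_distrib_right)
  also have "\<dots> = (\<Sum>j<m. \<Sum>i<n. A $$ (i, j) * x $ j * cnj (y $ i))"
    by (rule sum.swap)
  also have "\<dots> = x \<bullet>c (mat_adjoint A *\<^sub>v y)"
    using assms by (simp add: scalar_prod_def lessThan_atLeast0 sum_distrib_left cnj_sum mult_ac)
  finally show ?thesis .
qed

lemma l2_norm_vec_isometry:
  assumes "Q \<in> carrier_mat n m" "mat_adjoint Q * Q = 1\<^sub>m m" "x \<in> carrier_vec m"
  shows "l2_norm_vec (Q *\<^sub>v x) = l2_norm_vec x"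
proof -
  have "(Q *\<^sub>v x) \<bullet>c (Q *\<^sub>v x) = x \<bullet>c (mat_adjoint Q *\<^sub>v (Q *\<^sub>v x))"
    using assms by (intro cscalar_prod_adjoint) auto
  also have "mat_adjoint Q *\<^sub>v (Q *\<^sub>v x) = x"
    using assms by (subst assoc_mult_mat_vec[symmetric]) auto
  finally have "(l2_norm_vec (Q *\<^sub>v x))\<^sup>2 = (l2_norm_vec x)\<^sup>2"
    by (simp only: of_real_l2_norm_vec_power2[symmetric] of_real_eq_iff)
  then show ?thesis by simp
qed

lemma l2_norm_vec_unitary:
  assumes "unitary_mat n Q" "x \<in> carrier_vec n"
  shows "l2_norm_vec (Q *\<^sub>v x) = l2_norm_vec x"
    "l2_norm_vec (mat_adjoint Q *\<^sub>v x) = l2_norm_vec x"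
  using assms by (auto simp: unitary_mat_def intro!: l2_norm_vec_isometry[of _ n n])

lemma unitary_mat_mult:
  assumes "unitary_mat n P" "unitary_mat n Q"
  shows "unitary_mat n (P * Q)"
proof -
  have [simp]: "dim_row P = n" "dim_col P = n" "dim_row Q = n" "dim_col Q = n"
    using assms by (auto simp: unitary_mat_def)
  have "mat_adjoint (P * Q) * (P * Q) = mat_adjoint Q * ((mat_adjoint P * P) * Q)"
    by (simp add: mat_adjoint_mult mult_mat_assoc)
  moreover have "(P * Q) * mat_adjoint (P * Q) = P * ((Q * mat_adjoint Q) * mat_adjoint P)"
    by (simp add: mat_adjoint_mult mult_mat_assoc)
  ultimately show ?thesis
    using assms by (auto simp: unitary_mat_def)
qed

section \<open>Diagonalization of Hermitian matrices\<close>

lemma elements_mat_subset_iff: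
  "elements_mat A \<subseteq> K \<longleftrightarrow> (\<forall>i<dim_row A. \<forall>j<dim_col A. A $$ (i, j) \<in> K)"
  by (fastforce dest: elements_matD intro: elements_matI[OF carrier_matI])

lemma elements_mat_mult_scalars:
  assumes "K = UNIV \<or> K = \<real>" "(A :: complex mat) \<in> carrier_mat n m" "B \<in> carrier_mat m k"
    and "elements_mat A \<subseteq> K" "elements_mat B \<subseteq> K"
  shows "elements_mat (A * B) \<subseteq> K"
  using assms unfolding elements_mat_subset_iff
  by (auto simp: scalar_prod_def intro!: sum_in_Reals Reals_mult)

lemma elements_mat_adjoint_scalars:
  fixes A :: "complex mat"
  assumes "K = UNIV \<or> K = \<real>" "elements_mat A \<subseteq> K"
  shows "elements_mat (mat_adjoint A) \<subseteq> K"
  using assms by (auto simp: elements_mat_subset_iff complex_is_Real_iff)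

text \<open>Completes a multiple of \<open>v\<close> to a unitary matrix by one explicit reflection.
  Its entries come from those of \<open>v\<close> by field operations and real scalars, so a real
  \<open>v\<close> gives a real matrix.\<close>

lemma householder:
  fixes v :: "complex vec"
  assumes K: "K = UNIV \<or> K = \<real>"
    and v: "v \<in> carrier_vec n" "v \<noteq> 0\<^sub>v n" "\<And>i. i < n \<Longrightarrow> v $ i \<in> K" and "0 < n"
  obtains P c where "unitary_mat n P" "elements_mat P \<subseteq> K" "col P 0 = c \<cdot>\<^sub>v v"
proof -
  \<comment> \<open>The phase \<open>t\<close> makes the first coordinate of \<open>w\<close> real; a reflection can map \<open>e\<^sub>0\<close> to \<open>w\<close> only then.\<close>
  define t where "t = (if v $ 0 = 0 then 1 else cnj (v $ 0) / complex_of_real (cmod (v $ 0)))"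
  define c where "c = t / complex_of_real (l2_norm_vec v)"
  define w where "w = c \<cdot>\<^sub>v v"
  have nv: "l2_norm_vec v \<noteq> 0" using v by (auto simp: l2_norm_vec_eq_0_iff)
  have t: "cmod t = 1" "t \<in> K"
    using K v(3)[OF \<open>0 < n\<close>] by (auto simp: t_def norm_divide complex_is_Real_iff Reals_divide)
  have w: "dim_vec w = n" "l2_norm_vec w = 1"
    using v nv t by (auto simp: w_def c_def l2_norm_vec_smult norm_divide)
  have wK: "w $ i \<in> K" if "i < n" for i
    using K t(2) v(3)[OF that] v(1) that by (auto simp: w_def c_def Reals_mult Reals_divide)
  have "w $ 0 \<in> \<real>"
    using \<open>0 < n\<close> v(1) by (auto simp: w_def c_def t_def mult.commute simp flip: complex_norm_square of_real_mult of_real_power of_real_divide)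
  then have w0: "cnj (w $ 0) = w $ 0" by (simp add: Reals_cnj_iff)
  have sumw: "(\<Sum>i<n. w $ i * cnj (w $ i)) = 1"
    using of_real_l2_norm_vec_power2[of w] w
    by (simp add: scalar_prod_def lessThan_atLeast0)
  show ?thesis
  \<comment> \<open>If \<open>w\<close> is already the first unit vector, the reflection vector
    below vanishes, and the identity matrix takes over.\<close>
  proof (cases "w = unit_vec n 0")
    case True
    show ?thesis
      by (rule that[of "1\<^sub>m n" c])
        (use True K \<open>0 < n\<close> in \<open>auto simp: unitary_mat_def w_def elements_mat_subset_iff\<close>)
  next
    case False
    \<comment> \<open>The reflection swapping the first unit vector and \<open>w\<close> has
      direction \<open>u\<close>, their difference. As \<open>w\<close> is a unit vector with real
      first coordinate, \<open>d\<close> is half the squared norm of \<open>u\<close>, so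
      \<open>P\<close> below is the usual reflection \<open>1 - 2 u u^* / |u|^2\<close>.\<close>
    define u where "u i = w $ i - (if i = 0 then 1 else 0)" for i
    define d where "d = 1 - w $ 0"
    have sumu: "(\<Sum>i<n. cnj (u i) * u i) = 2 * d"
    proof -
      have "cnj (u i) * u i = w $ i * cnj (w $ i) + (if i = 0 then 1 - 2 * w $ 0 else 0)" for i
        by (simp add: u_def w0 algebra_simps)
      then show ?thesis
        using \<open>0 < n\<close> by (simp add: sum.distrib sumw d_def algebra_simps)
    qed
    have d0: "d \<noteq> 0"
    proof
      assume "d = 0"
      have "complex_of_real (\<Sum>i<n. (cmod (u i))\<^sup>2) = (\<Sum>i<n. cnj (u i) * u i)"
        by (simp add: complex_norm_square mult.commute del: of_real_power)
      with \<open>d = 0\<close> sumu have "(\<Sum>i<n. (cmod (u i))\<^sup>2) = 0"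
        by (metis mult_zero_right of_real_eq_0_iff)
      then have "\<forall>i<n. u i = 0"
        by (subst (asm) sum_nonneg_eq_0_iff) auto
      then have "w = unit_vec n 0"
        using w(1) by (intro eq_vecI) (auto simp: u_def split: if_splits)
      then show False using False by simp
    qed
    have dcnj: "cnj d = d" by (simp add: d_def w0)
    define P where "P = mat n n (\<lambda>(i, j). (if i = j then 1 else 0) - u i * cnj (u j) / d)"
    have P [simp]: "P \<in> carrier_mat n n" by (simp add: P_def)
    have adj: "mat_adjoint P = P"
      by (rule eq_matI) (auto simp: P_def dcnj mult.commute)
    have "P * P = 1\<^sub>m n"
    proof (rule eq_matI)
      fix i j assume "i < dim_row (1\<^sub>m n :: complex mat)" "j < dim_col (1\<^sub>m n :: complex mat)"
      then have ij: "i < n" "j < n" by auto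
      have "(P * P) $$ (i, j) = (\<Sum>l<n. ((if i = l then 1 else 0) - u i * cnj (u l) / d) *
             ((if l = j then 1 else 0) - u l * cnj (u j) / d))"
        using ij by (simp add: P_def scalar_prod_def lessThan_atLeast0)
      also have "\<dots> = (\<Sum>l<n. (if l = i then (if i = j then 1 else 0) - u i * cnj (u j) / d else 0)
             - (if l = j then u i * cnj (u j) / d else 0)
             + u i * cnj (u j) / d\<^sup>2 * (cnj (u l) * u l))"
        by (rule sum.cong) (auto simp: algebra_simps power2_eq_square)
      also have "\<dots> = (if i = j then 1 else 0)"
        using ij d0 by (simp add: sum.distrib sum_subtractf sumu power2_eq_square
            sum_distrib_left[symmetric] del: sum_divide_distrib times_divide_eq_left times_divide_eq_right)
          (simp add: divide_simps)
      finally show "(P * P) $$ (i, j) = 1\<^sub>m n $$ (i, j)" using ij by simp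
    qed (auto simp: P_def)
    then have "unitary_mat n P" by (simp add: unitary_mat_def adj)
    moreover have "u i \<in> K" if "i < n" for i
      using K wK[OF that] by (auto simp: u_def)
    then have "elements_mat P \<subseteq> K"
      using K wK[OF \<open>0 < n\<close>] by (auto simp: elements_mat_subset_iff P_def d_def complex_is_Real_iff Reals_divide Reals_mult)
    moreover have "col P 0 = c \<cdot>\<^sub>v v"
      unfolding w_def[symmetric]
    proof (rule eq_vecI)
      fix i assume "i < dim_vec w"
      moreover have "cnj (u 0) = - d" by (simp add: u_def d_def w0)
      ultimately show "col P 0 $ i = w $ i"
        using w d0 \<open>0 < n\<close> by (simp add: P_def) (simp add: u_def)
    qed (use w in \<open>simp add: P_def\<close>)
    ultimately show ?thesis by (rule that)
  qed
qed

text \<open>The eigenvalue is real because \<open>H\<close> moves across the inner product. If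
  \<open>H\<close> is real too, the real and imaginary parts of a complex eigenvector both satisfy
  the eigenvector equation, and one of them is nonzero.\<close>

lemma hermitian_eigenvector:
  fixes H :: "complex mat"
  assumes K: "K = UNIV \<or> K = \<real>"
    and H: "H \<in> carrier_mat n n" "mat_adjoint H = H" "elements_mat H \<subseteq> K"
    and e: "eigenvalue H e"
  obtains v where "e \<in> \<real>" "v \<in> carrier_vec n" "v \<noteq> 0\<^sub>v n" "\<And>i. i < n \<Longrightarrow> v $ i \<in> K" "H *\<^sub>v v = e \<cdot>\<^sub>v v"
proof -
  obtain v where v: "v \<in> carrier_vec n" "v \<noteq> 0\<^sub>v n" "H *\<^sub>v v = e \<cdot>\<^sub>v v"
    using e H(1) by (auto simp: eigenvalue_def eigenvector_def)
  have "e * (v \<bullet>c v) = cnj e * (v \<bullet>c v)"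
    using cscalar_prod_adjoint[OF H(1) v(1) v(1)] v(1)
    by (simp add: H(2) v(3) conjugate_smult_vec)
  moreover have "v \<bullet>c v \<noteq> 0" using v by simp
  ultimately have e: "e \<in> \<real>" by (simp add: Reals_cnj_iff)
  from K show ?thesis
  proof
    assume "K = UNIV"
    then show ?thesis by (intro that[OF e v(1,2) _ v(3)]) auto
  next
    assume K: "K = \<real>"
    define x where "x = vec n (\<lambda>i. complex_of_real (Re (v $ i)))"
    define y where "y = vec n (\<lambda>i. complex_of_real (Im (v $ i)))"
    have eq: "(\<Sum>j<n. H $$ (i, j) * v $ j) = e * v $ i" if "i < n" for i
      using arg_cong[OF v(3), of "\<lambda>w. w $ i"] that H(1) v(1)
      by (simp add: scalar_prod_def lessThan_atLeast0)
    have HK: "Im (H $$ (i, j)) = 0" if "i < n" "j < n" for i j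
      using H that unfolding elements_mat_subset_iff by (auto simp: K complex_is_Real_iff)
    have eK: "Im e = 0" using e by (simp add: complex_is_Real_iff)
    have "H *\<^sub>v x = e \<cdot>\<^sub>v x"
    proof (rule eq_vecI)
      fix i assume "i < dim_vec (e \<cdot>\<^sub>v x)"
      then have i: "i < n" by (simp add: x_def)
      show "(H *\<^sub>v x) $ i = (e \<cdot>\<^sub>v x) $ i"
        using arg_cong[OF eq[OF i], of Re] i H(1) HK eK
        by (simp add: x_def scalar_prod_def lessThan_atLeast0 complex_eq_iff)
    qed (use H(1) in \<open>simp add: x_def\<close>)
    moreover have "H *\<^sub>v y = e \<cdot>\<^sub>v y"
    proof (rule eq_vecI)
      fix i assume "i < dim_vec (e \<cdot>\<^sub>v y)"
      then have i: "i < n" by (simp add: y_def)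
      show "(H *\<^sub>v y) $ i = (e \<cdot>\<^sub>v y) $ i"
        using arg_cong[OF eq[OF i], of Im] i H(1) HK eK
        by (simp add: y_def scalar_prod_def lessThan_atLeast0 complex_eq_iff)
    qed (use H(1) in \<open>simp add: y_def\<close>)
    moreover have "x \<noteq> 0\<^sub>v n \<or> y \<noteq> 0\<^sub>v n"
    proof (rule ccontr)
      assume "\<not> ?thesis"
      then have "x $ i = 0" "y $ i = 0" if "i < n" for i using that by auto
      then have "v = 0\<^sub>v n"
        using v(1) by (intro eq_vecI) (auto simp: x_def y_def complex_eq_iff)
      then show False using v(2) by simp
    qed
    ultimately show ?thesis
      using that[OF e, of x] that[OF e, of y] by (auto simp: K x_def y_def)
  qed
qed

lemma col_mult_mat:
  assumes "dim_col A = dim_row B" "j < dim_col B"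
  shows "col (A * B) j = A *\<^sub>v col (B :: 'a :: semiring_0 mat) j"
  by (rule eq_vecI) (use assms in auto)

lemma dim_mat_diag: "dim_row (mat_diag n f) = n" "dim_col (mat_diag n f) = n"
  by (simp_all add: mat_diag_def)

text \<open>Deflation: a unitary change of basis splits off one eigenvector, and induction treats
  the remaining block. The list \<open>es\<close> is given in advance, so that later the diagonal
  can be asked to appear in decreasing order.\<close>

lemma hermitian_diagonalization:
  fixes H :: "complex mat"
  assumes K: "K = UNIV \<or> K = \<real>"
    and "H \<in> carrier_mat n n" "mat_adjoint H = H" "elements_mat H \<subseteq> K"
    and "char_poly H = (\<Prod>e\<leftarrow>es. [:- e, 1:])"
  shows "\<exists>Q. unitary_mat n Q \<and> elements_mat Q \<subseteq> K \<and> H = Q * mat_diag n (\<lambda>i. es ! i) * mat_adjoint Q"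
  using assms(2-)
proof (induction n arbitrary: H es)
  case 0
  then show ?case
    by (intro exI[of _ "1\<^sub>m 0"]) (auto simp: unitary_mat_def elements_mat_subset_iff intro!: eq_matI)
next
  case (Suc n)
  note H = Suc.prems
  have "length es = Suc n"
    using degree_monic_char_poly[OF H(1)] degree_linear_factors[of uminus es] H(4) by simp
  then obtain e es' where es: "es = e # es'" by (cases es) auto
  have "eigenvalue H e"
    using eigenvalue_root_char_poly[OF H(1)] by (simp add: H(4) es)
  from hermitian_eigenvector[OF K H(1-3) this] obtain v where v: "e \<in> \<real>" "v \<in> carrier_vec (Suc n)"
    "v \<noteq> 0\<^sub>v (Suc n)" "\<And>i. i < Suc n \<Longrightarrow> v $ i \<in> K" "H *\<^sub>v v = e \<cdot>\<^sub>v v" by metis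
  from householder[OF K v(2-4)] obtain P c where P: "unitary_mat (Suc n) P" "elements_mat P \<subseteq> K"
    and colP: "col P 0 = c \<cdot>\<^sub>v v" by auto
  have Pc [simp]: "P \<in> carrier_mat (Suc n) (Suc n)" and PP: "mat_adjoint P * P = 1\<^sub>m (Suc n)"
    "P * mat_adjoint P = 1\<^sub>m (Suc n)"
    using P(1) by (auto simp: unitary_mat_def)
  have dims [simp]: "dim_row P = Suc n" "dim_col P = Suc n" "dim_row H = Suc n" "dim_col H = Suc n"
    using carrier_matD[OF Pc] carrier_matD[OF H(1)] by auto
  define H1 where "H1 = mat_adjoint P * (H * P)"
  have H1c: "H1 \<in> carrier_mat (Suc n) (Suc n)" by (auto simp: H1_def)
  have H1h: "mat_adjoint H1 = H1"
    by (simp add: H1_def mat_adjoint_mult H(2) mult_mat_assoc)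
  have H1K: "elements_mat H1 \<subseteq> K"
    unfolding H1_def
    by (rule elements_mat_mult_scalars[OF K, of _ "Suc n" "Suc n" _ "Suc n"]
        elements_mat_adjoint_scalars[OF K] P(2) H(3) mult_carrier_mat[OF H(1) Pc] H(1) Pc mat_adjoint_carrier[OF Pc])+
  have H_eq: "H = P * (H1 * mat_adjoint P)"
  proof -
    have "P * (H1 * mat_adjoint P) = (P * mat_adjoint P) * (H * (P * mat_adjoint P))"
      by (simp add: H1_def mult_mat_assoc)
    then show ?thesis using H(1) by (simp add: PP)
  qed
  \<comment> \<open>The first column of \<open>P\<close> is a multiple of an eigenvector, so the
    first column of \<open>H1\<close> is \<open>e\<close> times the first unit vector. Hermitian
    symmetry and \<open>e\<close> real then clear the first row.\<close>
  have col0: "H1 $$ (i, 0) = (if i = 0 then e else 0)" if "i < Suc n" for i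
  proof -
    have "col H1 0 = mat_adjoint P *\<^sub>v (H *\<^sub>v col P 0)"
      by (simp add: H1_def col_mult_mat)
    also have "H *\<^sub>v col P 0 = e \<cdot>\<^sub>v col P 0"
      using v(2,5) by (simp add: colP mult_mat_vec[OF H(1)] smult_smult_assoc mult.commute)
    also have "mat_adjoint P *\<^sub>v (e \<cdot>\<^sub>v col P 0) = e \<cdot>\<^sub>v (mat_adjoint P *\<^sub>v col P 0)"
      by (rule mult_mat_vec[of _ "Suc n" "Suc n"]) (auto intro: carrier_vecI)
    also have "mat_adjoint P *\<^sub>v col P 0 = col (mat_adjoint P * P) 0"
      by (simp add: col_mult_mat)
    finally have "col H1 0 $ i = (e \<cdot>\<^sub>v col (mat_adjoint P * P) 0) $ i" by simp
    then show ?thesis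
      using that H1c by (simp add: PP)
  qed
  define H' where "H' = mat n n (\<lambda>(i, j). H1 $$ (Suc i, Suc j))"
  have H'c [simp]: "H' \<in> carrier_mat n n" by (simp add: H'_def)
  define blk where
    "blk a X = four_block_mat (mat 1 1 (\<lambda>_. a)) (0\<^sub>m 1 n) (0\<^sub>m n 1) (X :: complex mat)" for a X
  have H1s: "cnj (H1 $$ (j, i)) = H1 $$ (i, j)" if "i < Suc n" "j < Suc n" for i j
    using arg_cong[OF H1h, of "\<lambda>M. M $$ (i, j)"] that H1c by simp
  have row0: "H1 $$ (0, i) = (if i = 0 then e else 0)" if "i < Suc n" for i
    using H1s[of 0 i] col0[OF that] that v(1) by (simp add: Reals_cnj_iff split: if_splits)
  have H1_blk: "H1 = blk e H'"
    by (rule eq_matI) (use H1c col0 row0 in \<open>auto simp: blk_def H'_def less_Suc_eq_0_disj not_less_eq\<close>)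
  \<comment> \<open>Similarity and the block form isolate the factor of \<open>e\<close>; cancelling
    it leaves the factorization over \<open>es'\<close> that the induction hypothesis asks
    for.\<close>
  have "char_poly H = char_poly H1"
    by (rule char_poly_similar, rule similar_matI[of _ _ P "mat_adjoint P" "Suc n"])
      (use H(1) H1c H_eq PP in \<open>auto simp: mult_mat_assoc\<close>)
  also have "\<dots> = char_poly (mat 1 1 (\<lambda>_. e)) * char_poly H'"
    unfolding H1_blk blk_def by (rule char_poly_four_block_zeros_col) auto
  also have "char_poly (mat 1 1 (\<lambda>_. e)) = [:- e, 1:]"
    by (subst char_poly_upper_triangular[of _ 1]) (auto simp: diag_mat_def)
  finally have cp: "char_poly H' = (\<Prod>e\<leftarrow>es'. [:- e, 1:])"
    by (simp add: H(4) es del: mult_pCons_left)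
  have "mat_adjoint H' = H'"
    by (rule eq_matI) (auto simp: H'_def H1s)
  moreover have "elements_mat H' \<subseteq> K"
    using H1K H1c by (auto simp: elements_mat_subset_iff H'_def)
  ultimately obtain Q' where Q': "unitary_mat n Q'" "elements_mat Q' \<subseteq> K"
    "H' = Q' * mat_diag n (\<lambda>i. es' ! i) * mat_adjoint Q'"
    using Suc.IH[OF H'c _ _ cp] by blast
  have [simp]: "Q' \<in> carrier_mat n n" "dim_row Q' = n" "dim_col Q' = n"
    using Q'(1) by (auto simp: unitary_mat_def)
  have blk_mult: "blk a X * blk b Y = blk (a * b) (X * Y)"
    if "dim_row X = n" "dim_col X = n" "dim_row Y = n" "dim_col Y = n" for a b X Y
  proof -
    have "X \<in> carrier_mat n n" "Y \<in> carrier_mat n n" using that by auto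
    then show ?thesis
      by (intro eq_matI) (auto simp: blk_def mult_four_block_mat[of _ 1 1 _ n _ n _ _ 1 _ n] scalar_prod_def)
  qed
  have blk_adj: "mat_adjoint (blk a X) = blk (cnj a) (mat_adjoint X)" if "X \<in> carrier_mat n n" for a X
    by (rule eq_matI) (use that in \<open>auto simp: blk_def\<close>)
  have blk_one: "blk 1 (1\<^sub>m n) = 1\<^sub>m (Suc n)"
    by (rule eq_matI) (auto simp: blk_def)
  define B where "B = blk 1 Q'"
  have B: "unitary_mat (Suc n) B"
    using Q'(1) by (auto simp: unitary_mat_def B_def blk_adj blk_mult blk_one)
      (auto simp: blk_def intro: carrier_matI)
  have [simp]: "dim_row B = Suc n" "dim_col B = Suc n" by (auto simp: B_def blk_def)
  have BK: "elements_mat B \<subseteq> K"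
    using K Q'(2) by (auto simp: elements_mat_subset_iff B_def blk_def)
  have diag: "mat_diag (Suc n) (\<lambda>i. es ! i) = blk e (mat_diag n (\<lambda>i. es' ! i))"
    by (rule eq_matI) (auto simp: blk_def mat_diag_def es nth_Cons')
  have "H1 = B * mat_diag (Suc n) (\<lambda>i. es ! i) * mat_adjoint B"
    by (simp add: B_def diag blk_adj blk_mult H1_blk Q'(3) dim_mat_diag)
  then have "H = (P * B) * mat_diag (Suc n) (\<lambda>i. es ! i) * mat_adjoint (P * B)"
    using H_eq by (simp add: mat_adjoint_mult mult_mat_assoc mat_diag_def)
  moreover have "elements_mat (P * B) \<subseteq> K"
    using B by (intro elements_mat_mult_scalars[OF K _ _ P(2) BK, of "Suc n" "Suc n" "Suc n"]) (auto simp: unitary_mat_def)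
  ultimately show ?case
    using unitary_mat_mult[OF P(1) B] by blast
qed

section \<open>Singular values and low-rank approximation\<close>

text \<open>At an eigenvector \<open>v\<close>, the eigenvalue is the quotient of the squared norms
  of \<open>A v\<close> and \<open>v\<close>.\<close>

lemma gram_eigenvalue:
  fixes A :: "complex mat"
  assumes A: "A \<in> carrier_mat n m" and e: "eigenvalue (mat_adjoint A * A) e"
  shows "complex_of_real (Re e) = e" "0 \<le> Re e"
proof -
  obtain v where v: "v \<in> carrier_vec m" "v \<noteq> 0\<^sub>v m" "(mat_adjoint A * A) *\<^sub>v v = e \<cdot>\<^sub>v v"
    using e A by (auto simp: eigenvalue_def eigenvector_def)
  have "(A *\<^sub>v v) \<bullet>c (A *\<^sub>v v) = v \<bullet>c (e \<cdot>\<^sub>v v)"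
    using cscalar_prod_adjoint[OF A v(1), of "A *\<^sub>v v"] A v
    by (simp add: mult_mat_vec_assoc[symmetric])
  then have eq: "complex_of_real ((l2_norm_vec (A *\<^sub>v v))\<^sup>2) = cnj e * complex_of_real ((l2_norm_vec v)\<^sup>2)"
    using v(1) by (simp only: of_real_l2_norm_vec_power2) (simp add: conjugate_smult_vec)
  have pos: "(l2_norm_vec v)\<^sup>2 > 0"
    using v by (auto simp: l2_norm_vec_eq_0_iff)
  have "Re e * (l2_norm_vec v)\<^sup>2 = (l2_norm_vec (A *\<^sub>v v))\<^sup>2"
    using arg_cong[OF eq, of Re] by (simp add: of_real_power[symmetric] del: of_real_power)
  then show "0 \<le> Re e"
    using pos by (metis zero_le_power2 zero_le_mult_iff not_less)
  have "Im e * (l2_norm_vec v)\<^sup>2 = 0"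
    using arg_cong[OF eq, of Im] by (simp add: of_real_power[symmetric] del: of_real_power)
  then show "complex_of_real (Re e) = e"
    using pos by (simp add: complex_eq_iff)
qed

text \<open>Links the root multiset in the definition of \<open>singular_value\<close> to an
  explicit list of eigenvalues.\<close>

lemma proots_linear_factors: "proots (\<Prod>a\<leftarrow>as. [:- a, 1:]) = mset (as :: complex list)"
proof (induction as)
  case (Cons a as)
  have "(\<Prod>a\<leftarrow>as. [:- a, 1:]) \<noteq> 0" by (auto simp: prod_list_zero_iff)
  then show ?case
    using Cons proots_mult[of "[:- a, 1:]" "\<Prod>a\<leftarrow>as. [:- a, 1:]"]
    by (simp del: mult_pCons_left)
qed simp

text \<open>Stands in for the existence of a singular value decomposition: the columns of
  \<open>Q\<close> are right singular vectors in decreasing order, and left singular vectors are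
  never constructed.\<close>

lemma gram_diagonalization:
  fixes A :: "complex mat"
  assumes K: "K = UNIV \<or> K = \<real>" and A: "A \<in> carrier_mat n m" "elements_mat A \<subseteq> K"
  obtains Q where "unitary_mat m Q" "elements_mat Q \<subseteq> K"
    "mat_adjoint A * A = Q * mat_diag m (\<lambda>i. complex_of_real ((singular_value A (i + 1))\<^sup>2)) * mat_adjoint Q"
    "\<And>i. i < m \<Longrightarrow> 0 \<le> singular_value A (i + 1)"
    "\<And>i j. i \<le> j \<Longrightarrow> j < m \<Longrightarrow> singular_value A (j + 1) \<le> singular_value A (i + 1)"
proof -
  let ?H = "mat_adjoint A * A" and ?f = "\<lambda>z. sqrt (Re z)"
  have H: "?H \<in> carrier_mat m m" "mat_adjoint ?H = ?H"
    using A(1) by (auto simp: mat_adjoint_mult)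
  have HK: "elements_mat ?H \<subseteq> K"
    using A by (intro elements_mat_mult_scalars[OF K] elements_mat_adjoint_scalars[OF K]) auto
  obtain as where as: "char_poly ?H = (\<Prod>a\<leftarrow>as. [:- a, 1:])" "length as = m"
    using char_poly_factorized[OF H(1)] by blast
  \<comment> \<open>Sorting the complex eigenvalues by the real key \<open>sqrt (Re z)\<close> and
    reversing makes position \<open>i\<close> hold the square of the singular value with 1-based
    index \<open>i + 1\<close>.\<close>
  define es where "es = rev (sort_key ?f as)"
  have len: "length es = m" by (simp add: es_def as)
  have ms: "mset es = mset as" by (simp add: es_def)
  have cp: "char_poly ?H = (\<Prod>e\<leftarrow>es. [:- e, 1:])"
    unfolding as(1) by (simp add: ms flip: prod_mset_prod_list)
  have ev: "complex_of_real (Re e) = e" "0 \<le> Re e" if "e \<in> set es" for e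
  proof -
    have "eigenvalue ?H e"
      using that by (subst eigenvalue_root_char_poly[OF H(1)])
        (auto simp: cp poly_prod_list prod_list_zero_iff)
    from gram_eigenvalue[OF A(1) this] show "complex_of_real (Re e) = e" "0 \<le> Re e" by auto
  qed
  have "sort (map ?f as) = map ?f (sort_key ?f as)"
    by (rule properties_for_sort) auto
  then have sv: "singular_value A (i + 1) = ?f (es ! i)" if "i < m" for i
    using that len
    by (simp add: singular_value_def as(1) proots_linear_factors es_def rev_map
        mset_map[symmetric] del: mset_map)
  have "sorted (rev (map ?f es))"
    by (simp add: es_def rev_map)
  then have mono: "?f (es ! j) \<le> ?f (es ! i)" if "i \<le> j" "j < m" for i j
    using that len sorted_rev_nth_mono[of "map ?f es" i j] by simp
  obtain Q where Q: "unitary_mat m Q" "elements_mat Q \<subseteq> K"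
    "?H = Q * mat_diag m (\<lambda>i. es ! i) * mat_adjoint Q"
    using hermitian_diagonalization[OF K H HK cp] by blast
  have "mat_diag m (\<lambda>i. es ! i) = mat_diag m (\<lambda>i. complex_of_real ((singular_value A (i + 1))\<^sup>2))"
  proof (rule eq_matI)
    fix i j
    assume "i < dim_row (mat_diag m (\<lambda>i. complex_of_real ((singular_value A (i + 1))\<^sup>2)))"
      "j < dim_col (mat_diag m (\<lambda>i. complex_of_real ((singular_value A (i + 1))\<^sup>2)))"
    then have "i < m" "j < m" by (auto simp: mat_diag_def)
    then show "mat_diag m (\<lambda>i. es ! i) $$ (i, j) =
        mat_diag m (\<lambda>i. complex_of_real ((singular_value A (i + 1))\<^sup>2)) $$ (i, j)"
      using ev[of "es ! j"] len
      by (simp only: mat_diag_def index_mat prod.case sv) (simp add: of_real_power[symmetric] del: of_real_power)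
  qed (auto simp: mat_diag_def)
  with Q have gram: "?H = Q * mat_diag m (\<lambda>i. complex_of_real ((singular_value A (i + 1))\<^sup>2)) * mat_adjoint Q"
    by simp
  have nonneg: "0 \<le> singular_value A (i + 1)" if "i < m" for i
    using sv[OF that] ev[of "es ! i"] that len by simp
  have decr: "singular_value A (j + 1) \<le> singular_value A (i + 1)" if "i \<le> j" "j < m" for i j
    using sv[of i] sv[of j] mono[OF that] that by simp
  show ?thesis
    by (rule that[OF Q(1,2) gram nonneg decr])
qed

lemma index_mat_diag_mult_vec:
  assumes "dim_vec v = n" "i < n"
  shows "(mat_diag n f *\<^sub>v v) $ i = f i * (v $ i :: 'a :: semiring_0)"
  using assms by (simp add: mat_diag_def scalar_prod_def if_distrib[of "\<lambda>x. x * _"] cong: if_cong)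

lemma gram_norm:
  fixes A :: "complex mat"
  assumes A: "A \<in> carrier_mat n m" and Q: "Q \<in> carrier_mat m m"
    and gram: "mat_adjoint A * A = Q * mat_diag m (\<lambda>i. complex_of_real (d i)) * mat_adjoint Q"
    and x: "x \<in> carrier_vec m"
  shows "(l2_norm_vec (A *\<^sub>v x))\<^sup>2 = (\<Sum>i<m. d i * (cmod ((mat_adjoint Q *\<^sub>v x) $ i))\<^sup>2)"
proof -
  define D where "D = mat_diag m (\<lambda>i. complex_of_real (d i))"
  define y where "y = mat_adjoint Q *\<^sub>v x"
  have dims [simp]: "dim_row D = m" "dim_col D = m" "dim_row Q = m" "dim_col Q = m"
    "dim_row A = n" "dim_col A = m" "dim_vec x = m" "dim_vec y = m"
    using A Q x by (auto simp: D_def mat_diag_def y_def)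
  have "(A *\<^sub>v x) \<bullet>c (A *\<^sub>v x) = x \<bullet>c ((mat_adjoint A * A) *\<^sub>v x)"
    using cscalar_prod_adjoint[OF A x, of "A *\<^sub>v x"] by (simp add: mult_mat_vec_assoc carrier_vecI)
  also have "\<dots> = x \<bullet>c (mat_adjoint (mat_adjoint Q) *\<^sub>v (D *\<^sub>v y))"
    unfolding gram D_def[symmetric] by (simp add: mult_mat_vec_assoc y_def)
  also have "\<dots> = y \<bullet>c (D *\<^sub>v y)"
    using cscalar_prod_adjoint[of "mat_adjoint Q" m m x "D *\<^sub>v y"] Q x
    by (simp add: y_def carrier_vecI)
  also have "\<dots> = (\<Sum>i<m. complex_of_real (d i * (cmod (y $ i))\<^sup>2))"
  proof -
    have "(D *\<^sub>v y) $ i = complex_of_real (d i) * y $ i" if "i < m" for i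
      using that by (simp add: D_def index_mat_diag_mult_vec)
    then show ?thesis
      by (simp add: scalar_prod_def lessThan_atLeast0 complex_norm_square mult_ac del: of_real_power)
  qed
  finally have "complex_of_real ((l2_norm_vec (A *\<^sub>v x))\<^sup>2) = complex_of_real (\<Sum>i<m. d i * (cmod (y $ i))\<^sup>2)"
    by (simp only: of_real_l2_norm_vec_power2 of_real_sum)
  then show ?thesis by (simp only: of_real_eq_iff y_def)
qed

section \<open>Truncation to rank \<open>r\<close>\<close>

lemma rank_sum_products_le:
  fixes f g :: "nat \<Rightarrow> nat \<Rightarrow> complex"
  shows "vec_space.rank n (mat n m (\<lambda>(i, j). \<Sum>l<k. f l i * g l j)) \<le> k"
proof (induction k)
  case 0
  have "mat n m (\<lambda>(i, j). \<Sum>l<0::nat. f l i * g l j) = 0\<^sub>m n m" by (rule eq_matI) auto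
  then show ?case by (simp only: vec_space.rank_0I)
next
  case (Suc k)
  let ?M = "\<lambda>k. mat n m (\<lambda>(i, j). \<Sum>l<k. f l i * g l j)" and ?N = "mat n m (\<lambda>(i, j). f k i * g k j)"
  have "?M (Suc k) = ?M k + ?N" by (rule eq_matI) auto
  then have "vec_space.rank n (?M (Suc k)) \<le> vec_space.rank n (?M k) + vec_space.rank n ?N"
    by (simp only:) (rule vec_space.rank_subadditive[of _ _ m]; simp)
  moreover have "vec_space.rank n ?N \<le> 1"
    by (rule vec_space.rank_le_1_product_entries[of _ _ m "f k" "g k"]) auto
  ultimately show ?case using Suc by linarith
qed

text \<open>\<open>Y\<close> agrees with \<open>A\<close> on the span of the \<open>r\<close>
  leading right singular vectors and vanishes on its orthogonal complement, so \<open>A - Y\<close>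
  only sees the trailing coordinates. As \<open>Q\<close> has entries in \<open>K\<close>, so has
  \<open>Y\<close>, which makes it an admissible competitor for the best approximation over
  \<open>K\<close>.\<close>

lemma low_rank_approximation:
  fixes A :: "complex mat"
  assumes K: "K = UNIV \<or> K = \<real>" and A: "A \<in> carrier_mat n m" "elements_mat A \<subseteq> K" and "r < m"
  obtains Y where "Y \<in> carrier_mat n m" "elements_mat Y \<subseteq> K" "mat_rank Y \<le> r"
    "\<And>x. x \<in> carrier_vec m \<Longrightarrow> l2_norm_vec ((A - Y) *\<^sub>v x) \<le> singular_value A (r + 1) * l2_norm_vec x"
proof -
  from gram_diagonalization[OF K A] obtain Q where Q: "unitary_mat m Q" "elements_mat Q \<subseteq> K"
    and gram: "mat_adjoint A * A = Q * mat_diag m (\<lambda>i. complex_of_real ((singular_value A (i + 1))\<^sup>2)) * mat_adjoint Q"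
    and nonneg: "\<And>i. i < m \<Longrightarrow> 0 \<le> singular_value A (i + 1)"
    and mono: "\<And>i j. i \<le> j \<Longrightarrow> j < m \<Longrightarrow> singular_value A (j + 1) \<le> singular_value A (i + 1)"
    by blast
  have Qc: "Q \<in> carrier_mat m m" and QQ: "mat_adjoint Q * Q = 1\<^sub>m m" "Q * mat_adjoint Q = 1\<^sub>m m"
    using Q(1) by (auto simp: unitary_mat_def)
  define D where "D = mat_diag m (\<lambda>i. if i < r then 1 else 0 :: complex)"
  define B where "B = A * Q"
  define Y where "Y = B * D * mat_adjoint Q"
  have dims [simp]: "dim_row D = m" "dim_col D = m" "dim_row Q = m" "dim_col Q = m"
    "dim_row A = n" "dim_col A = m" "dim_row B = n" "dim_col B = m"
    using A Qc by (auto simp: D_def mat_diag_def B_def)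
  have Yc: "Y \<in> carrier_mat n m" and [simp]: "dim_row Y = n" "dim_col Y = m"
    by (simp_all add: Y_def carrier_matI)
  have "elements_mat B \<subseteq> K"
    unfolding B_def by (rule elements_mat_mult_scalars[OF K A(1) Qc A(2) Q(2)])
  then have "elements_mat (B * D) \<subseteq> K"
    by (rule elements_mat_mult_scalars[OF K, of _ n m _ m, rotated 2])
      (use K in \<open>auto simp: elements_mat_subset_iff D_def mat_diag_def B_def intro!: carrier_matI\<close>)
  then have YK: "elements_mat Y \<subseteq> K"
    unfolding Y_def by (rule elements_mat_mult_scalars[OF K, of _ n m _ m, rotated 2])
      (simp_all add: carrier_matI elements_mat_adjoint_scalars[OF K Q(2)])
  have BD: "(B * D) $$ (i, l) = (if l < r then B $$ (i, l) else 0)" if "i < n" "l < m" for i l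
    unfolding D_def using that by (subst mat_diag_mult_right[of _ n]) (auto intro: carrier_matI)
  have "Y = mat n m (\<lambda>(i, j). \<Sum>l<r. B $$ (i, l) * mat_adjoint Q $$ (l, j))"
  proof (rule eq_matI)
    fix i j
    assume "i < dim_row (mat n m (\<lambda>(i, j). \<Sum>l<r. B $$ (i, l) * mat_adjoint Q $$ (l, j)))"
      "j < dim_col (mat n m (\<lambda>(i, j). \<Sum>l<r. B $$ (i, l) * mat_adjoint Q $$ (l, j)))"
    then have ij: "i < n" "j < m" by auto
    then have "Y $$ (i, j) = (\<Sum>l<m. (B * D) $$ (i, l) * mat_adjoint Q $$ (l, j))"
      by (simp add: Y_def scalar_prod_def lessThan_atLeast0)
    also have "\<dots> = (\<Sum>l<m. if l < r then B $$ (i, l) * mat_adjoint Q $$ (l, j) else 0)"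
      using ij by (intro sum.cong) (auto simp: BD simp del: index_mult_mat(1))
    also have "\<dots> = (\<Sum>l<r. B $$ (i, l) * mat_adjoint Q $$ (l, j))"
      using \<open>r < m\<close> by (intro sum.mono_neutral_cong_right) auto
    finally show "Y $$ (i, j) = mat n m (\<lambda>(i, j). \<Sum>l<r. B $$ (i, l) * mat_adjoint Q $$ (l, j)) $$ (i, j)"
      using ij by simp
  qed auto
  then have rank: "mat_rank Y \<le> r"
    using rank_sum_products_le[where n = n and m = m and k = r and
        f = "\<lambda>l i. B $$ (i, l)" and g = "\<lambda>l j. mat_adjoint Q $$ (l, j)"] by simp
  have "l2_norm_vec ((A - Y) *\<^sub>v x) \<le> singular_value A (r + 1) * l2_norm_vec x" if x: "x \<in> carrier_vec m" for x
  proof -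
    define y where "y = mat_adjoint Q *\<^sub>v x"
    \<comment> \<open>\<open>z\<close> is the tail of the coordinates \<open>y\<close> of
      \<open>x\<close> in the basis of right singular vectors; the error at \<open>x\<close> is
      \<open>A\<close> applied to that tail.\<close>
    define z where "z = vec m (\<lambda>i. if i < r then 0 else y $ i)"
    have [simp]: "dim_vec x = m" "dim_vec y = m" "dim_vec z = m" using x by (auto simp: y_def z_def)
    have Dy: "D *\<^sub>v y = y - z"
    proof (rule eq_vecI)
      fix i assume "i < dim_vec (y - z)"
      then have i: "i < m" by simp
      then show "(D *\<^sub>v y) $ i = (y - z) $ i" by (simp add: z_def D_def index_mat_diag_mult_vec)
    qed simp
    have Qy: "Q *\<^sub>v y = x"
      using x by (simp add: y_def mult_mat_vec_assoc[symmetric] QQ)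
    have "Y *\<^sub>v x = B *\<^sub>v (y - z)"
      by (simp add: Y_def mult_mat_vec_assoc y_def[symmetric] Dy)
    also have "\<dots> = B *\<^sub>v y - B *\<^sub>v z"
      by (rule mult_minus_distrib_mat_vec[of _ n m]) (auto intro: carrier_vecI carrier_matI)
    also have "B *\<^sub>v y = A *\<^sub>v x" by (simp add: B_def mult_mat_vec_assoc Qy)
    finally have Yx: "Y *\<^sub>v x = A *\<^sub>v x - B *\<^sub>v z" .
    have "(A - Y) *\<^sub>v x = A *\<^sub>v x - Y *\<^sub>v x"
      by (rule minus_mult_distrib_mat_vec[OF A(1) Yc x])
    also have "\<dots> = A *\<^sub>v (Q *\<^sub>v z)"
      unfolding Yx by (rule eq_vecI) (auto simp: B_def mult_mat_vec_assoc)
    finally have eq: "(A - Y) *\<^sub>v x = A *\<^sub>v (Q *\<^sub>v z)" .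
    have "(l2_norm_vec ((A - Y) *\<^sub>v x))\<^sup>2 = (\<Sum>i<m. (singular_value A (i + 1))\<^sup>2 * (cmod ((mat_adjoint Q *\<^sub>v (Q *\<^sub>v z)) $ i))\<^sup>2)"
      unfolding eq by (rule gram_norm[OF A(1) Qc gram]) (auto intro: carrier_vecI)
    also have "mat_adjoint Q *\<^sub>v (Q *\<^sub>v z) = z"
      by (simp add: mult_mat_vec_assoc[symmetric] QQ carrier_vecI)
    also have "(\<Sum>i<m. (singular_value A (i + 1))\<^sup>2 * (cmod (z $ i))\<^sup>2)
        \<le> (\<Sum>i<m. (singular_value A (r + 1))\<^sup>2 * (cmod (y $ i))\<^sup>2)"
    proof (rule sum_mono)
      fix i assume "i \<in> {..<m}"
      then show "(singular_value A (i + 1))\<^sup>2 * (cmod (z $ i))\<^sup>2 \<le> (singular_value A (r + 1))\<^sup>2 * (cmod (y $ i))\<^sup>2"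
        using nonneg[of i] mono[of r i] by (auto simp: z_def intro!: mult_right_mono power_mono)
    qed
    also have "\<dots> = (singular_value A (r + 1))\<^sup>2 * (l2_norm_vec y)\<^sup>2"
      by (simp add: l2_norm_vec_power2 sum_distrib_left)
    also have "l2_norm_vec y = l2_norm_vec x"
      unfolding y_def by (rule l2_norm_vec_unitary[OF Q(1) x])
    finally have sq: "(l2_norm_vec ((A - Y) *\<^sub>v x))\<^sup>2 \<le> (singular_value A (r + 1))\<^sup>2 * (l2_norm_vec x)\<^sup>2" .
    show ?thesis
      by (rule power2_le_imp_le) (use sq nonneg[OF \<open>r < m\<close>] in \<open>auto simp: power_mult_distrib\<close>)
  qed
  then show ?thesis by (rule that[OF Yc YK rank])
qed

section \<open>Operator norm and the error of the best approximation\<close>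

lemma spectral_norm_le:
  assumes "0 \<le> c" "\<And>x. x \<in> carrier_vec (dim_col X) \<Longrightarrow> l2_norm_vec (X *\<^sub>v x) \<le> c * l2_norm_vec x"
  shows "spectral_norm X \<le> c"
  unfolding spectral_norm_def
proof (rule cSup_least)
  have "0\<^sub>v (dim_col X) \<in> carrier_vec (dim_col X)" "l2_norm_vec (0\<^sub>v (dim_col X)) \<le> 1"
    using l2_norm_vec_eq_0_iff[of "0\<^sub>v (dim_col X)"] by auto
  then show "{l2_norm_vec (X *\<^sub>v v) |v. v \<in> carrier_vec (dim_col X) \<and> l2_norm_vec v \<le> 1} \<noteq> {}" by blast
  fix a assume "a \<in> {l2_norm_vec (X *\<^sub>v v) |v. v \<in> carrier_vec (dim_col X) \<and> l2_norm_vec v \<le> 1}"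
  then obtain v where v: "a = l2_norm_vec (X *\<^sub>v v)" "v \<in> carrier_vec (dim_col X)" "l2_norm_vec v \<le> 1" by auto
  show "a \<le> c"
    using assms(2)[OF v(2)] mult_left_mono[OF v(3) assms(1)] v(1) by simp
qed

lemma l2_norm_vec_mult_mat_le:
  assumes x: "x \<in> carrier_vec (dim_col X)"
  shows "l2_norm_vec (X *\<^sub>v x) \<le> spectral_norm X * l2_norm_vec x"
proof (cases "l2_norm_vec x = 0")
  case True
  then have "X *\<^sub>v x = X *\<^sub>v 0\<^sub>v (dim_col X)" using x by (simp add: l2_norm_vec_eq_0_iff)
  also have "\<dots> = 0\<^sub>v (dim_row X)" by (rule eq_vecI) auto
  finally have "l2_norm_vec (X *\<^sub>v x) = 0" by (simp add: l2_norm_vec_eq_0_iff)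
  then show ?thesis using True by simp
next
  case False
  let ?S = "{l2_norm_vec (X *\<^sub>v v) |v. v \<in> carrier_vec (dim_col X) \<and> l2_norm_vec v \<le> 1}"
  \<comment> \<open>A supremum of reals bounds its members only for a set bounded above.
    Cauchy-Schwarz on each row supplies the bound, which is the Frobenius norm of
    \<open>X\<close>.\<close>
  have "bdd_above ?S"
  proof (rule bdd_aboveI)
    fix a assume "a \<in> ?S"
    then obtain v where v: "a = l2_norm_vec (X *\<^sub>v v)" "v \<in> carrier_vec (dim_col X)" "l2_norm_vec v \<le> 1" by auto
    show "a \<le> L2_set (\<lambda>i. l2_norm_vec (row X i)) {..<dim_row X}"
      unfolding v(1) l2_norm_vec_L2_set[of "X *\<^sub>v v"] dim_mult_mat_vec
    proof (rule L2_set_mono)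
      fix i assume "i \<in> {..<dim_row X}"
      then have "cmod ((X *\<^sub>v v) $ i) \<le> l2_norm_vec (row X i) * l2_norm_vec v"
        using v(2) by (auto intro!: cmod_scalar_prod_le)
      also have "\<dots> \<le> l2_norm_vec (row X i)"
        using v(3) by (simp add: mult_left_le)
      finally show "cmod ((X *\<^sub>v v) $ i) \<le> l2_norm_vec (row X i)" .
    qed simp
  qed
  moreover define c where "c = complex_of_real (1 / l2_norm_vec x)"
  have "l2_norm_vec (X *\<^sub>v (c \<cdot>\<^sub>v x)) \<in> ?S"
    using x False by (auto simp: c_def l2_norm_vec_smult norm_divide)
  ultimately have "l2_norm_vec (X *\<^sub>v (c \<cdot>\<^sub>v x)) \<le> spectral_norm X"
    unfolding spectral_norm_def by (rule cSup_upper[rotated])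
  also have "X *\<^sub>v (c \<cdot>\<^sub>v x) = c \<cdot>\<^sub>v (X *\<^sub>v x)"
    using x by (intro mult_mat_vec[of _ "dim_row X" "dim_col X"]) auto
  finally show ?thesis
    using False less_le[of 0 "l2_norm_vec x"] by (simp add: c_def l2_norm_vec_smult norm_divide field_simps)
qed

text \<open>Optimality of \<open>Z\<close> in the spectral norm is tested against the truncation
  over \<open>K\<close> from \<open>low_rank_approximation\<close>.\<close>

lemma best_rank_approx_error:
  assumes K: "K = UNIV \<or> K = \<real>" and A: "A \<in> carrier_mat n m" "elements_mat A \<subseteq> K" and "r < m"
    and Z: "best_rank_approx K r A Z" and x: "x \<in> carrier_vec m"
  shows "l2_norm_vec ((A - Z) *\<^sub>v x) \<le> singular_value A (r + 1) * l2_norm_vec x"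
proof -
  from low_rank_approximation[OF K A \<open>r < m\<close>] obtain Y where Y: "Y \<in> carrier_mat n m" "elements_mat Y \<subseteq> K"
    "mat_rank Y \<le> r"
    "\<And>x. x \<in> carrier_vec m \<Longrightarrow> l2_norm_vec ((A - Y) *\<^sub>v x) \<le> singular_value A (r + 1) * l2_norm_vec x"
    by blast
  have Zc: "Z \<in> carrier_mat n m" using Z A by (auto simp: best_rank_approx_def)
  have "0 \<le> singular_value A (r + 1)"
    using gram_diagonalization[OF K A] \<open>r < m\<close> by metis
  then have "spectral_norm (A - Y) \<le> singular_value A (r + 1)"
    using Y(1,4) by (intro spectral_norm_le) auto
  moreover have "spectral_norm (A - Z) \<le> spectral_norm (A - Y)"
    using Z Y(1-3) A(1) by (auto simp: best_rank_approx_def)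
  ultimately have "spectral_norm (A - Z) * l2_norm_vec x \<le> singular_value A (r + 1) * l2_norm_vec x"
    by (intro mult_right_mono) auto
  then show ?thesis
    using l2_norm_vec_mult_mat_le[of x "A - Z"] x Zc by simp
qed

section \<open>The pseudo-inverse\<close>

lemma mult_minus_mat:
  assumes "dim_col A = dim_row B" "dim_row B = dim_row C" "dim_col B = dim_col C"
  shows "A * (B - C) = A * B - A * (C :: 'a :: ring mat)"
  using assms by (intro mult_minus_distrib_mat) auto

lemma minus_mult_mat:
  assumes "dim_col A = dim_row C" "dim_row A = dim_row B" "dim_col A = dim_col B"
  shows "(A - B) * C = A * C - B * (C :: 'a :: ring mat)"
  using assms by (intro minus_mult_distrib_mat) auto

lemma minus_mult_mat_vec:
  assumes "dim_col A = dim_vec v" "dim_row A = dim_row B" "dim_col A = dim_col B"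
  shows "(A - B) *\<^sub>v v = A *\<^sub>v v - B *\<^sub>v (v :: 'a :: ring vec)"
  using assms by (intro minus_mult_distrib_mat_vec) auto

text \<open>The diagonal of the Gram matrix holds the squared column norms.\<close>

lemma adjoint_mult_self_eq_0:
  fixes X :: "complex mat"
  assumes "mat_adjoint X * X = 0\<^sub>m (dim_col X) (dim_col X)"
  shows "X = 0\<^sub>m (dim_row X) (dim_col X)"
proof (rule eq_matI)
  fix i j
  assume "i < dim_row (0\<^sub>m (dim_row X) (dim_col X) :: complex mat)"
    "j < dim_col (0\<^sub>m (dim_row X) (dim_col X) :: complex mat)"
  then have ij: "i < dim_row X" "j < dim_col X" by auto
  have "complex_of_real ((l2_norm_vec (col X j))\<^sup>2) = (mat_adjoint X * X) $$ (j, j)"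
    using ij by (simp only: of_real_l2_norm_vec_power2) (simp add: scalar_prod_def mult.commute)
  then have "l2_norm_vec (col X j) = 0"
    using ij by (simp add: assms)
  then have "col X j = 0\<^sub>v (dim_row X)"
    by (simp add: l2_norm_vec_eq_0_iff)
  then have "col X j $ i = 0\<^sub>v (dim_row X) $ i" by simp
  then show "X $$ (i, j) = 0\<^sub>m (dim_row X) (dim_col X) $$ (i, j)"
    using ij by simp
qed auto

text \<open>\<open>X\<close> is \<open>G\<close> times the adjoint of \<open>B\<close>, where
  \<open>G\<close> inverts the Gram matrix on its nonzero eigenvalues. Then \<open>X B\<close> is
  the spectral projection \<open>E\<close> for those eigenvalues, and the Penrose equations reduce
  to \<open>B E = B\<close>.\<close>

lemma pseudo_inverse_exists:
  fixes B :: "complex mat"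
  shows "\<exists>X. is_pseudo_inverse B X"
proof -
  define m where "m = dim_col B"
  have "B \<in> carrier_mat (dim_row B) m" by (simp add: m_def)
  then obtain Q where Q: "unitary_mat m Q"
    and gram: "mat_adjoint B * B = Q * mat_diag m (\<lambda>i. complex_of_real ((singular_value B (i + 1))\<^sup>2)) * mat_adjoint Q"
    by (rule gram_diagonalization[OF disjI1[OF refl] _ subset_UNIV]) (rule that)
  define d where "d i = (singular_value B (i + 1))\<^sup>2" for i
  have dims [simp]: "dim_row Q = m" "dim_col Q = m" "dim_col B = m"
    and QQ: "mat_adjoint Q * Q = 1\<^sub>m m" "Q * mat_adjoint Q = 1\<^sub>m m"
    using Q by (auto simp: unitary_mat_def m_def)
  have QQ': "mat_adjoint Q * (Q * Y) = Y" if "dim_row Y = m" for Y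
  proof -
    have "mat_adjoint Q * (Q * Y) = 1\<^sub>m m * Y" using that by (simp add: mult_mat_assoc[symmetric] QQ)
    also have "\<dots> = Y" using that by (intro left_mult_one_mat) auto
    finally show ?thesis .
  qed
  define g where "g i = complex_of_real (if d i = 0 then 0 else 1 / d i)" for i
  define D where "D = mat_diag m (\<lambda>i. complex_of_real (d i))"
  define D' where "D' = mat_diag m g"
  have [simp]: "dim_row D = m" "dim_col D = m" "dim_row D' = m" "dim_col D' = m"
    by (auto simp: D_def D'_def mat_diag_def)
  have adjD [simp]: "mat_adjoint D = D" "mat_adjoint D' = D'"
    by (auto simp: D_def D'_def g_def[abs_def])
  have DD: "D' * D = D * D'" "D' * (D * D') = D'" "D * (D' * D) = D"
    unfolding D_def D'_def mat_diag_diag by (auto simp: g_def mult.commute intro!: arg_cong[of _ _ "mat_diag m"])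
  have DD': "D' * (D * (D' * Y)) = D' * Y" "D * (D' * (D * Y)) = D * Y" if "dim_row Y = m" for Y
    using that DD(2,3) by (simp_all add: mult_mat_assoc[symmetric])
  have H: "mat_adjoint B * B = Q * (D * mat_adjoint Q)"
    by (simp add: gram D_def d_def[abs_def] mult_mat_assoc dim_mat_diag)
  define G where "G = Q * (D' * mat_adjoint Q)"
  define X where "X = G * mat_adjoint B"
  define E where "E = Q * (D' * (D * mat_adjoint Q))"
  have [simp]: "dim_row G = m" "dim_col G = m" "dim_row E = m" "dim_col E = m"
    "dim_row X = m" "dim_col X = dim_row B"
    by (auto simp: G_def E_def X_def)
  have adjG: "mat_adjoint G = G" by (simp add: G_def mat_adjoint_mult mult_mat_assoc)
  have XB: "X * B = E" by (simp add: X_def mult_mat_assoc H E_def G_def QQ')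
  have adjE: "mat_adjoint E = E"
    by (simp add: E_def mat_adjoint_mult mult_mat_assoc)
       (simp add: mult_mat_assoc[symmetric] DD(1))
  have EG: "E * G = G" by (simp add: E_def G_def mult_mat_assoc QQ' DD')
  have HE: "mat_adjoint B * (B * E) = mat_adjoint B * B"
    by (simp add: mult_mat_assoc[symmetric]) (simp add: H E_def mult_mat_assoc QQ' DD')
  \<comment> \<open>The Gram matrix only gives that the adjoint of \<open>B\<close> annihilates
    \<open>F\<close>. Since \<open>F\<close> itself has left factor \<open>B\<close>, the Gram
    matrix of \<open>F\<close> vanishes, and so does \<open>F\<close>.\<close>
  have BE: "B * E = B"
  proof -
    define F where "F = B * E - B"
    have [simp]: "dim_row F = dim_row B" "dim_col F = m" by (auto simp: F_def)
    have "mat_adjoint B * F = 0\<^sub>m m m"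
      unfolding F_def by (subst mult_minus_mat) (auto simp: HE intro!: minus_r_inv_mat)
    moreover have "F = B * (E - 1\<^sub>m m)"
      unfolding F_def by (subst mult_minus_mat) auto
    ultimately have "mat_adjoint F * F = 0\<^sub>m m m"
      by (simp add: mat_adjoint_mult mult_mat_assoc)
    then have "F = 0\<^sub>m (dim_row B) m"
      using adjoint_mult_self_eq_0[of F] by simp
    then have *: "F $$ (i, j) = 0" if "i < dim_row B" "j < m" for i j
      using that by simp
    show ?thesis
      by (rule eq_matI) (use * in \<open>auto simp: F_def simp del: index_mult_mat(1)\<close>)
  qed
  have "is_pseudo_inverse B X"
    unfolding is_pseudo_inverse_def
  proof (intro conjI)
    show "X \<in> carrier_mat (dim_col B) (dim_row B)" by (rule carrier_matI) simp_all
    show "B * X * B = B" by (simp add: mult_mat_assoc XB BE)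
    have "X * B * X = E * G * mat_adjoint B" unfolding XB by (simp add: X_def mult_mat_assoc)
    then show "X * B * X = X" by (simp add: EG X_def)
    show "mat_adjoint (B * X) = B * X" by (simp add: X_def mat_adjoint_mult mult_mat_assoc adjG)
    show "mat_adjoint (X * B) = X * B" by (simp add: XB adjE)
  qed
  then show ?thesis ..
qed

text \<open>\<open>B X\<close> and \<open>B Y\<close> are Hermitian and absorb each other, hence
  coincide, and likewise \<open>X B\<close> and \<open>Y B\<close>. Thus
  \<open>X = X B X = Y B X = Y B Y = Y\<close>.\<close>

lemma pseudo_inverse_unique:
  assumes "is_pseudo_inverse B X" "is_pseudo_inverse B Y"
  shows "X = Y"
proof -
  have dims [simp]: "dim_row X = dim_col B" "dim_col X = dim_row B" "dim_row Y = dim_col B" "dim_col Y = dim_row B"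
    using assms by (auto simp: is_pseudo_inverse_def)
  have X: "B * (X * B) = B" "X * (B * X) = X" "mat_adjoint (B * X) = B * X" "mat_adjoint (X * B) = X * B"
    and Y: "B * (Y * B) = B" "Y * (B * Y) = Y" "mat_adjoint (B * Y) = B * Y" "mat_adjoint (Y * B) = Y * B"
    using assms by (auto simp: is_pseudo_inverse_def mult_mat_assoc)
  have "B * X = (B * Y) * (B * X)"
    using Y(1) by (simp add: mult_mat_assoc[symmetric])
  also have "\<dots> = mat_adjoint ((B * X) * (B * Y))"
    by (subst mat_adjoint_mult) (simp_all add: X(3) Y(3))
  also have "(B * X) * (B * Y) = B * Y"
    using X(1) by (simp add: mult_mat_assoc[symmetric])
  finally have BX: "B * X = B * Y" by (simp add: Y(3))
  have "X * B = (X * B) * (Y * B)"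
    using Y(1) by (simp add: mult_mat_assoc)
  also have "\<dots> = mat_adjoint ((Y * B) * (X * B))"
    by (subst mat_adjoint_mult) (simp_all add: X(4) Y(4))
  also have "(Y * B) * (X * B) = Y * B"
    using X(1) by (simp add: mult_mat_assoc)
  finally have XB: "X * B = Y * B" by (simp add: Y(4))
  have "X = (X * B) * X" by (simp add: mult_mat_assoc X)
  also have "\<dots> = Y * (B * X)" by (simp add: XB mult_mat_assoc)
  also have "\<dots> = Y" by (simp add: BX Y)
  finally show ?thesis .
qed

lemma is_pseudo_inverse_pseudo_inverse: "is_pseudo_inverse B (pseudo_inverse B)"
  unfolding pseudo_inverse_def
  by (rule theI') (use pseudo_inverse_exists pseudo_inverse_unique in blast)

text \<open>The squared norm of \<open>P x\<close> is the inner product of \<open>x\<close> with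
  \<open>P x\<close>; Cauchy-Schwarz and cancelling one factor finish.\<close>

lemma l2_norm_vec_projection_le:
  fixes P :: "complex mat"
  assumes P: "P \<in> carrier_mat n n" "mat_adjoint P = P" "P * P = P" and x: "x \<in> carrier_vec n"
  shows "l2_norm_vec (P *\<^sub>v x) \<le> l2_norm_vec x"
proof -
  have Px: "P *\<^sub>v x \<in> carrier_vec n" using P(1) x by auto
  have "(P *\<^sub>v x) \<bullet>c (P *\<^sub>v x) = x \<bullet>c (P *\<^sub>v (P *\<^sub>v x))"
    using cscalar_prod_adjoint[OF P(1) x Px] by (simp only: P(2))
  also have "\<dots> = x \<bullet>c (P *\<^sub>v x)"
    by (simp only: assoc_mult_mat_vec[OF P(1) P(1) x, symmetric] P(3))
  finally have "complex_of_real ((l2_norm_vec (P *\<^sub>v x))\<^sup>2) = x \<bullet>c (P *\<^sub>v x)"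
    by (simp only: of_real_l2_norm_vec_power2)
  then have "(l2_norm_vec (P *\<^sub>v x))\<^sup>2 = cmod (x \<bullet>c (P *\<^sub>v x))"
    by (metis norm_of_real abs_of_nonneg zero_le_power2)
  also have "\<dots> \<le> l2_norm_vec x * l2_norm_vec (conjugate (P *\<^sub>v x))"
    using P x by (intro cmod_scalar_prod_le) auto
  also have "l2_norm_vec (conjugate (P *\<^sub>v x)) = l2_norm_vec (P *\<^sub>v x)"
    by (simp add: l2_norm_vec_def)
  finally show ?thesis
    using l2_norm_vec_nonneg[of "P *\<^sub>v x"] l2_norm_vec_nonneg[of x]
    by (auto simp: power2_eq_square mult_le_cancel_right not_less
        intro: order_trans[OF _ l2_norm_vec_nonneg])
qed

text \<open>\<open>1 - P\<close> is again an orthogonal projection.\<close>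

lemma l2_norm_vec_coprojection_le:
  fixes P :: "complex mat"
  assumes P: "P \<in> carrier_mat n n" "mat_adjoint P = P" "P * P = P" and x: "x \<in> carrier_vec n"
  shows "l2_norm_vec (x - P *\<^sub>v x) \<le> l2_norm_vec x"
proof -
  have [simp]: "dim_row P = n" "dim_col P = n" "dim_vec x = n" using P(1) x by auto
  have Ps: "cnj (P $$ (j, i)) = P $$ (i, j)" if "i < n" "j < n" for i j
    using arg_cong[OF P(2), of "\<lambda>M. M $$ (i, j)"] that by simp
  have adj: "mat_adjoint (1\<^sub>m n - P) = 1\<^sub>m n - P"
    by (rule eq_matI) (auto simp: Ps)
  have "(1\<^sub>m n - P) * (1\<^sub>m n - P) = (1\<^sub>m n - P) - (P - P)"
    by (subst mult_minus_mat; (subst minus_mult_mat)?; simp add: minus_mult_mat P)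
  also have "\<dots> = 1\<^sub>m n - P" by (rule eq_matI) auto
  finally have "l2_norm_vec ((1\<^sub>m n - P) *\<^sub>v x) \<le> l2_norm_vec x"
    by (intro l2_norm_vec_projection_le[OF _ adj _ x]) (auto intro: carrier_matI)
  then show ?thesis using x by (simp add: minus_mult_mat_vec)
qed

text \<open>Padding with a zero row gives a square matrix of determinant zero, which has a nonzero
  kernel vector.\<close>

lemma wide_mat_kernel:
  fixes F :: "complex mat"
  assumes F: "F \<in> carrier_mat r (Suc r)"
  obtains c where "c \<in> carrier_vec (Suc r)" "c \<noteq> 0\<^sub>v (Suc r)" "F *\<^sub>v c = 0\<^sub>v r"
proof -
  define S where "S = mat (Suc r) (Suc r) (\<lambda>(i, j). if i < r then F $$ (i, j) else 0)"
  have Sc: "S \<in> carrier_mat (Suc r) (Suc r)" by (simp add: S_def)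
  have "S = mat\<^sub>r (Suc r) (Suc r) (\<lambda>i. if i = r then 0\<^sub>v (Suc r) else row S i)"
    by (rule eq_matI) (auto simp: S_def)
  then have "det S = det (mat\<^sub>r (Suc r) (Suc r) (\<lambda>i. if i = r then 0\<^sub>v (Suc r) else row S i))"
    by (rule arg_cong)
  also have "\<dots> = 0"
    using Sc by (intro det_row_0) auto
  finally have "det S = 0" .
  then obtain c where c: "c \<in> carrier_vec (Suc r)" "c \<noteq> 0\<^sub>v (Suc r)" "S *\<^sub>v c = 0\<^sub>v (Suc r)"
    using det_0_iff_vec_prod_zero[OF Sc] by auto
  have "F *\<^sub>v c = 0\<^sub>v r"
  proof (rule eq_vecI)
    fix i assume "i < dim_vec (0\<^sub>v r :: complex vec)"
    then have i: "i < r" by simp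
    have "(S *\<^sub>v c) $ i = (F *\<^sub>v c) $ i"
      using i F c(1) by (simp add: S_def scalar_prod_def)
    then show "(F *\<^sub>v c) $ i = 0\<^sub>v r $ i" using i by (simp add: c(3))
  qed (use F in simp)
  with c show ?thesis by (intro that)
qed

section \<open>Selections and dominant interpolation\<close>

lemma bij_betw_pick:
  assumes "finite I"
  shows "bij_betw (pick I) {..<card I} I"
proof -
  have inj: "inj_on (pick I) {..<card I}"
    by (rule linorder_inj_onI) (use pick_mono_le[of _ I] in \<open>fastforce+\<close>)
  moreover have "pick I ` {..<card I} = I"
    by (rule card_subset_eq) (use assms pick_in_set_le[of _ I] inj in \<open>auto simp: card_image\<close>)
  ultimately show ?thesis by (simp add: bij_betw_def)
qed

lemma pick_lessThan: "k < r \<Longrightarrow> pick {..<r} k = k"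
proof -
  assume k: "k < r"
  then have "{a \<in> {..<r}. a < k} = {..<k}" by auto
  then show ?thesis using pick_card_in_set[of k "{..<r}"] k by simp
qed

text \<open>Makes taking rows a left multiplication, so that the error identity becomes matrix
  algebra. The adjoint puts coordinates back at the positions in \<open>I\<close>, with zeros
  elsewhere.\<close>

definition row_selector :: "nat \<Rightarrow> nat set \<Rightarrow> complex mat" where
  "row_selector n I = mat (card I) n (\<lambda>(k, j). if j = pick I k then 1 else 0)"

lemma dim_row_selector [simp]: "dim_row (row_selector n I) = card I" "dim_col (row_selector n I) = n"
  by (simp_all add: row_selector_def)

lemma pick_less:
  assumes "I \<subseteq> {..<n}" "k < card I"
  shows "pick I k < n"
  using assms pick_in_set_le by blast

lemma card_restrict_subset: "I \<subseteq> {..<n :: nat} \<Longrightarrow> card {i. i < n \<and> i \<in> I} = card I"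
  by (rule arg_cong[of _ _ card]) auto

lemma index_row_selector_mult:
  assumes "dim_row X = n" "I \<subseteq> {..<n}" "k < card I" "j < dim_col X"
  shows "(row_selector n I * X) $$ (k, j) = X $$ (pick I k, j)"
  using assms pick_less[OF assms(2,3)]
  by (simp add: row_selector_def scalar_prod_def if_distrib[of "\<lambda>x. x * _"] cong: if_cong)

lemma rows_submatrix_eq_mult:
  assumes "I \<subseteq> {..<dim_row X}"
  shows "rows_submatrix X I = row_selector (dim_row X) I * X"
  by (rule eq_matI)
    (use assms in \<open>simp_all add: rows_submatrix_def submatrix_def card_restrict_subset
      index_row_selector_mult pick_UNIV del: index_mult_mat(1)\<close>)

lemma transpose_rows_submatrix_transpose:
  "transpose_mat (rows_submatrix (transpose_mat X) J) = cols_submatrix X J"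
proof -
  have "pick UNIV i < dim_row X" if "i < dim_row X" for i using that by (simp add: pick_UNIV)
  then show ?thesis
    by (intro eq_matI) (auto simp: rows_submatrix_def cols_submatrix_def submatrix_def pick_le)
qed

lemma transpose_row_selector: "transpose_mat (row_selector n I) = mat_adjoint (row_selector n I)"
  by (rule eq_matI) (auto simp: row_selector_def)

lemma cols_submatrix_eq_mult:
  assumes "J \<subseteq> {..<dim_col X}"
  shows "cols_submatrix X J = X * mat_adjoint (row_selector (dim_col X) J)"
proof -
  have "cols_submatrix X J = transpose_mat (row_selector (dim_col X) J * transpose_mat X)"
    using assms by (simp add: rows_submatrix_eq_mult flip: transpose_rows_submatrix_transpose)
  also have "\<dots> = transpose_mat (transpose_mat X) * transpose_mat (row_selector (dim_col X) J)"
    by (rule transpose_mult[of _ "card J" "dim_col X"]) auto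
  finally show ?thesis by (simp add: transpose_row_selector)
qed

lemma row_selector_mult_adjoint:
  assumes "I \<subseteq> {..<n}"
  shows "row_selector n I * mat_adjoint (row_selector n I) = 1\<^sub>m (card I)"
proof (rule eq_matI)
  fix k l assume "k < dim_row (1\<^sub>m (card I) :: complex mat)" "l < dim_col (1\<^sub>m (card I) :: complex mat)"
  then have kl: "k < card I" "l < card I" by auto
  have "finite I" using assms finite_subset by blast
  then have "pick I k = pick I l \<longleftrightarrow> k = l"
    using kl bij_betw_pick[of I] by (auto simp: bij_betw_def inj_on_eq_iff)
  then show "(row_selector n I * mat_adjoint (row_selector n I)) $$ (k, l) = 1\<^sub>m (card I) $$ (k, l)"
    using kl assms pick_less[OF assms kl(1)]
    by (subst index_row_selector_mult) (auto simp: row_selector_def)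
qed auto

lemma l2_norm_vec_adjoint_row_selector:
  assumes "I \<subseteq> {..<n}" "dim_vec t = card I"
  shows "l2_norm_vec (mat_adjoint (row_selector n I) *\<^sub>v t) = l2_norm_vec t"
  by (rule l2_norm_vec_isometry[of _ n "card I"])
    (use assms in \<open>auto simp: row_selector_mult_adjoint intro: carrier_matI carrier_vecI\<close>)

text \<open>Selecting and putting back is an orthogonal projection, and putting back preserves
  norms.\<close>

lemma l2_norm_vec_row_selector_le:
  assumes "I \<subseteq> {..<n}" "dim_vec v = n"
  shows "l2_norm_vec (row_selector n I *\<^sub>v v) \<le> l2_norm_vec v"
proof -
  let ?L = "row_selector n I"
  have L1: "?L * (mat_adjoint ?L * ?L) = ?L"
  proof -
    have "?L * (mat_adjoint ?L * ?L) = 1\<^sub>m (card I) * ?L"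
      by (simp add: row_selector_mult_adjoint[OF assms(1)] mult_mat_assoc[symmetric])
    then show ?thesis by simp
  qed
  have "l2_norm_vec (?L *\<^sub>v v) = l2_norm_vec (mat_adjoint ?L *\<^sub>v (?L *\<^sub>v v))"
    using assms(1) by (simp add: l2_norm_vec_adjoint_row_selector)
  also have "\<dots> = l2_norm_vec ((mat_adjoint ?L * ?L) *\<^sub>v v)"
    using assms(2) by (simp add: mult_mat_vec_assoc)
  also have "\<dots> \<le> l2_norm_vec v"
    by (rule l2_norm_vec_projection_le[of _ n])
      (use assms in \<open>auto simp: mat_adjoint_mult mult_mat_assoc L1 intro: carrier_matI carrier_vecI\<close>)
  finally show ?thesis .
qed

section \<open>Norms of interpolation errors\<close>

lemma l2_norm_vec_pythagoras:
  assumes "u \<in> carrier_vec n" "v \<in> carrier_vec n" "u \<bullet>c v = 0"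
  shows "(l2_norm_vec (u - v))\<^sup>2 = (l2_norm_vec u)\<^sup>2 + (l2_norm_vec v)\<^sup>2"
proof -
  have "v \<bullet>c u = conjugate (u \<bullet>c v)"
    using assms(1,2) by (simp add: scalar_prod_def mult.commute)
  then have vu: "v \<bullet>c u = 0" by (simp add: assms(3))
  have "(u - v) \<bullet>c (u - v) = (\<Sum>i<n. u $ i * cnj (u $ i) + v $ i * cnj (v $ i) - u $ i * cnj (v $ i) - v $ i * cnj (u $ i))"
    using assms(1,2) by (auto simp: scalar_prod_def lessThan_atLeast0 algebra_simps intro!: sum.cong)
  also have "\<dots> = u \<bullet>c u + v \<bullet>c v - u \<bullet>c v - v \<bullet>c u"
    using assms(1,2) by (simp add: scalar_prod_def lessThan_atLeast0 sum.distrib sum_subtractf)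
  also have "\<dots> = u \<bullet>c u + v \<bullet>c v" by (simp add: vu assms(3))
  finally have "complex_of_real ((l2_norm_vec (u - v))\<^sup>2) = complex_of_real ((l2_norm_vec u)\<^sup>2 + (l2_norm_vec v)\<^sup>2)"
    by (simp only: of_real_l2_norm_vec_power2 of_real_add)
  then show ?thesis by (simp only: of_real_eq_iff)
qed

lemma l2_norm_unit_vec: "j < n \<Longrightarrow> l2_norm_vec (unit_vec n j) = 1"
  by (simp add: l2_norm_vec_def unit_vec_def if_distrib[of "\<lambda>x. x\<^sup>2"] if_distrib[of cmod] cong: if_cong)

text \<open>The unit vector at \<open>j\<close> is orthogonal to every vector supported on
  \<open>I\<close>, so Pythagoras applies. This covers the rows of \<open>1 - T L\<close> and the
  columns of \<open>1 - H G\<close> outside the selected indices.\<close>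

lemma l2_norm_interpolation_outside:
  assumes I: "I \<subseteq> {..<n}" and j: "j < n" "j \<notin> I" and t: "dim_vec t = card I"
  shows "l2_norm_vec (unit_vec n j - mat_adjoint (row_selector n I) *\<^sub>v t) = sqrt (1 + (l2_norm_vec t)\<^sup>2)"
proof -
  let ?L = "row_selector n I"
  have "?L *\<^sub>v unit_vec n j = 0\<^sub>v (card I)"
  proof (rule eq_vecI)
    fix k assume "k < dim_vec (0\<^sub>v (card I) :: complex vec)"
    then have k: "k < card I" by simp
    then have "pick I k \<noteq> j" using j(2) pick_in_set_le by metis
    then show "(?L *\<^sub>v unit_vec n j) $ k = 0\<^sub>v (card I) $ k"
      using j k by (auto simp: row_selector_def)
  qed simp
  moreover have "?L \<in> carrier_mat (card I) n" "t \<in> carrier_vec (card I)"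
    using t by (auto intro: carrier_matI carrier_vecI)
  ultimately have "unit_vec n j \<bullet>c (mat_adjoint ?L *\<^sub>v t) = 0"
    using cscalar_prod_adjoint[of ?L "card I" n "unit_vec n j" t] t by simp
  then have "(l2_norm_vec (unit_vec n j - mat_adjoint ?L *\<^sub>v t))\<^sup>2 = 1 + (l2_norm_vec t)\<^sup>2"
    using j t by (subst l2_norm_vec_pythagoras[of _ n])
      (auto simp: l2_norm_unit_vec l2_norm_vec_adjoint_row_selector[OF I] intro: carrier_vecI)
  then show ?thesis by (metis real_sqrt_unique l2_norm_vec_nonneg)
qed

text \<open>At a selected index the unit vector is itself in the image of the isometry, so the norm
  can be computed in the small space.\<close>

lemma l2_norm_interpolation_inside:
  assumes I: "I \<subseteq> {..<n}" and l: "l < card I" and t: "dim_vec t = card I"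
  shows "l2_norm_vec (unit_vec n (pick I l) - mat_adjoint (row_selector n I) *\<^sub>v t) = l2_norm_vec (unit_vec (card I) l - t)"
proof -
  let ?L = "row_selector n I"
  have "mat_adjoint ?L *\<^sub>v unit_vec (card I) l = unit_vec n (pick I l)"
    by (rule eq_vecI) (use l pick_less[OF I l] in \<open>auto simp: row_selector_def\<close>)
  moreover have "mat_adjoint ?L *\<^sub>v (unit_vec (card I) l - t) = mat_adjoint ?L *\<^sub>v unit_vec (card I) l - mat_adjoint ?L *\<^sub>v t"
    using t by (intro mult_minus_distrib_mat_vec[of _ n "card I"]) (auto intro: carrier_matI carrier_vecI)
  ultimately show ?thesis
    using l2_norm_vec_adjoint_row_selector[OF I, of "unit_vec (card I) l - t"] t by simp
qed

text \<open>Modifies the minimum norm solution so that it is the identity on the basis rows; the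
  matching rows of \<open>1 - T L\<close> then vanish.\<close>

lemma dominant_basis_rows_interpolation:
  assumes dom: "dominant_basis_rows B k I"
  obtains T where "T \<in> carrier_mat (dim_row B) k" "T * rows_submatrix B I = B"
    "\<And>l. l < k \<Longrightarrow> row T (pick I l) = unit_vec k l"
    "\<And>i. i < dim_row B \<Longrightarrow> i \<notin> I \<Longrightarrow> l2_norm_vec (row T i) \<le> sqrt (real (dim_col B) / (real k + 1 - real (dim_col B)))"
proof -
  let ?p = "dim_row B" and ?BI = "rows_submatrix B I"
  have I: "I \<subseteq> {..<?p}" "card I = k" using dom by (auto simp: dominant_basis_rows_def)
  then have finI: "finite I" using finite_subset by blast
  have BI: "?BI = row_selector ?p I * B" by (rule rows_submatrix_eq_mult[OF I(1)])
  have dimBI [simp]: "dim_row ?BI = k" "dim_col ?BI = dim_col B" by (simp_all add: BI I)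
  obtain T0 where T0: "T0 \<in> carrier_mat ?p k" "T0 * ?BI = B"
    "\<And>i. i < ?p \<Longrightarrow> i \<notin> I \<Longrightarrow> l2_norm_vec (row T0 i) \<le> sqrt (real (dim_col B) / (real k + 1 - real (dim_col B)))"
    using dom dimBI by (auto simp: dominant_basis_rows_def min_norm_solution_def)
  \<comment> \<open>The assumed norm bound says nothing about the rows in \<open>I\<close>; there \<open>B\<close> interpolates itself.\<close>
  define T where "T = mat ?p k (\<lambda>(i, l). if i \<in> I then (if i = pick I l then 1 else 0) else T0 $$ (i, l))"
  have Tc [simp]: "dim_row T = ?p" "dim_col T = k" by (simp_all add: T_def)
  have pick_inj: "pick I l = pick I l' \<longleftrightarrow> l = l'" if "l < k" "l' < k" for l l'
    using that bij_betw_pick[OF finI] I(2) by (auto simp: bij_betw_def inj_on_eq_iff)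
  have row_in: "row T (pick I l) = unit_vec k l" if "l < k" for l
    by (rule eq_vecI) (use that pick_less[OF I(1), of l] pick_in_set_le[of l I] I(2) in \<open>auto simp: T_def pick_inj\<close>)
  have row_out: "row T i = row T0 i" if "i < ?p" "i \<notin> I" for i
    by (rule eq_vecI) (use that T0(1) in \<open>auto simp: T_def\<close>)
  have "T * ?BI = B"
  proof (rule eq_matI)
    fix i j assume ij: "i < dim_row B" "j < dim_col B"
    show "(T * ?BI) $$ (i, j) = B $$ (i, j)"
    proof (cases "i \<in> I")
      case True
      then obtain l where l: "l < k" "pick I l = i"
        using bij_betw_imp_surj_on[OF bij_betw_pick[OF finI]] I(2) by (metis imageE lessThan_iff)
      have "(T * ?BI) $$ (i, j) = ?BI $$ (l, j)"
        using ij l row_in[OF l(1)] by (simp add: scalar_prod_left_unit[of _ k] carrier_vecI)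
      also have "\<dots> = B $$ (i, j)"
        unfolding BI using ij l I by (subst index_row_selector_mult) auto
      finally show ?thesis .
    next
      case False
      have "(T * ?BI) $$ (i, j) = (T0 * ?BI) $$ (i, j)"
        using ij False T0(1) row_out[of i] by simp
      then show ?thesis by (simp add: T0(2))
    qed
  qed auto
  then show ?thesis
    using row_out T0(3) by (intro that[OF _ _ row_in]) (auto intro: carrier_matI)
qed

section \<open>Truncated singular value decompositions\<close>

lemma singular_value_nonneg:
  assumes "i < dim_col A"
  shows "0 \<le> singular_value A (i + 1)"
  by (rule gram_diagonalization[OF disjI1[OF refl] carrier_matI[OF refl refl] subset_UNIV])
    (use assms in blast)

lemma singular_value_antimono:
  assumes "i \<le> j" "j < dim_col A"
  shows "singular_value A (j + 1) \<le> singular_value A (i + 1)"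
  by (rule gram_diagonalization[OF disjI1[OF refl] carrier_matI[OF refl refl] subset_UNIV])
    (use assms in blast)

lemma index_singular_value_mat_mult_vec:
  assumes "dim_vec y = q" "i < p"
  shows "(singular_value_mat p q X *\<^sub>v y) $ i = (if i < q then complex_of_real (singular_value X (i + 1)) * y $ i else 0)"
  using assms
  by (auto simp: singular_value_mat_def scalar_prod_def if_distrib[of "\<lambda>x. x * _"] cong: if_cong)

lemma dim_singular_value_mat [simp]:
  "dim_row (singular_value_mat p q X) = p" "dim_col (singular_value_mat p q X) = q"
  by (simp_all add: singular_value_mat_def)

section \<open>Consequences of a given full decomposition \<open>R = P D Q\<close>\<close>

context
  fixes R P Q :: "complex mat" and n m :: nat
  assumes svd: "is_svd R P Q" and R: "R \<in> carrier_mat n m"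
begin

lemma svd_unitary: "unitary_mat n P" "unitary_mat m Q"
  using svd R by (auto simp: is_svd_def)

lemma svd_dims [simp]: "dim_row P = n" "dim_col P = n" "dim_row Q = m" "dim_col Q = m" "dim_row R = n" "dim_col R = m"
  using svd_unitary R by (auto simp: unitary_mat_def)

lemma svd_eq: "R = P * (singular_value_mat n m R * Q)"
  using svd R by (simp add: is_svd_def mult_mat_assoc)

context
  fixes r :: nat and U S V :: "complex mat"
  assumes r: "r \<le> n" "r \<le> m"
    and U: "U = cols_submatrix P {..<r}" and S: "S = singular_value_mat r r R" and V: "V = rows_submatrix Q {..<r}"
begin

lemma svd_left_eq: "U = P * mat_adjoint (row_selector n {..<r})"
  unfolding U using r by (subst cols_submatrix_eq_mult) auto

lemma svd_right_eq: "V = row_selector m {..<r} * Q"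
  unfolding V using r by (subst rows_submatrix_eq_mult) auto

lemma svd_left_adjoint_mult: "dim_row Y = n \<Longrightarrow> mat_adjoint U * (P * Y) = row_selector n {..<r} * Y"
proof -
  assume Y: "dim_row Y = n"
  have "mat_adjoint U * (P * Y) = row_selector n {..<r} * ((mat_adjoint P * P) * Y)"
    using Y by (simp add: svd_left_eq mat_adjoint_mult mult_mat_assoc)
  also have "(mat_adjoint P * P) * Y = Y"
    using svd_unitary(1) Y by (simp add: unitary_mat_def)
  finally show ?thesis .
qed

lemma svd_left_isometry: "mat_adjoint U * U = 1\<^sub>m r"
proof -
  have "mat_adjoint U * U = row_selector n {..<r} * mat_adjoint (row_selector n {..<r})"
    by (subst (2) svd_left_eq) (simp add: svd_left_adjoint_mult)
  then show ?thesis using r by (subst (asm) row_selector_mult_adjoint) auto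
qed

text \<open>The first \<open>r\<close> rows of the rectangular diagonal matrix are \<open>S\<close>
  padded with zero columns. Consequently \<open>U S V\<close> is the projection of \<open>R\<close>
  onto the span of the columns of \<open>U\<close>.\<close>

lemma svd_left_adjoint: "mat_adjoint U * R = S * V"
proof -
  have "row_selector n {..<r} * singular_value_mat n m R = S * row_selector m {..<r}"
  proof (rule eq_matI)
    fix i j assume "i < dim_row (S * row_selector m {..<r})" "j < dim_col (S * row_selector m {..<r})"
    then have ij: "i < r" "j < m" by (auto simp: S)
    have "(S * row_selector m {..<r}) $$ (i, j) = (\<Sum>k<r. S $$ (i, k) * row_selector m {..<r} $$ (k, j))"
      using ij by (simp add: S scalar_prod_def lessThan_atLeast0)
    also have "\<dots> = (\<Sum>k<r. if k = i then (if i = j then complex_of_real (singular_value R (i + 1)) else 0) else 0)"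
      using ij by (intro sum.cong) (auto simp: S singular_value_mat_def row_selector_def pick_lessThan)
    also have "\<dots> = (row_selector n {..<r} * singular_value_mat n m R) $$ (i, j)"
      using ij r by (subst index_row_selector_mult) (auto simp: pick_lessThan singular_value_mat_def)
    finally show "(row_selector n {..<r} * singular_value_mat n m R) $$ (i, j) = (S * row_selector m {..<r}) $$ (i, j)" ..
  qed (auto simp: S)
  moreover have "mat_adjoint U * R = row_selector n {..<r} * (singular_value_mat n m R * Q)"
    by (subst svd_eq) (simp add: svd_left_adjoint_mult)
  ultimately show ?thesis by (simp add: svd_right_eq mult_mat_assoc[symmetric] S)
qed

lemma svd_truncation_error:
  assumes c: "0 \<le> c" "\<And>i. r \<le> i \<Longrightarrow> i < n \<Longrightarrow> i < m \<Longrightarrow> singular_value R (i + 1) \<le> c"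
    and x: "x \<in> carrier_vec m"
  shows "l2_norm_vec ((R - U * S * V) *\<^sub>v x) \<le> c * l2_norm_vec x"
proof -
  let ?L = "row_selector n {..<r}"
  define y where "y = Q *\<^sub>v x"
  define z where "z = singular_value_mat n m R *\<^sub>v y"
  have [simp]: "dim_vec x = m" "dim_vec y = m" "dim_vec z = n" using x by (auto simp: y_def z_def)
  have dims [simp]: "dim_row U = n" "dim_col U = r" "dim_row S = r" "dim_col S = r" "dim_row V = r" "dim_col V = m"
    by (auto simp: svd_left_eq svd_right_eq S)
  have Rx: "R *\<^sub>v x = P *\<^sub>v z"
    by (subst svd_eq) (simp add: mult_mat_vec_assoc y_def z_def)
  have "(U * S * V) *\<^sub>v x = (U * (mat_adjoint U * R)) *\<^sub>v x"
    by (simp add: svd_left_adjoint mult_mat_assoc)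
  also have "\<dots> = U *\<^sub>v (mat_adjoint U *\<^sub>v (P *\<^sub>v z))"
    by (simp add: mult_mat_vec_assoc Rx)
  also have "\<dots> = P *\<^sub>v (mat_adjoint ?L *\<^sub>v (?L *\<^sub>v z))"
    using svd_unitary(1)
    by (simp add: svd_left_eq mat_adjoint_mult mult_mat_vec_assoc unitary_mat_def
        mult_mat_vec_assoc[of "mat_adjoint P" P z, symmetric] carrier_vecI)
  finally have "(R - U * S * V) *\<^sub>v x = P *\<^sub>v z - P *\<^sub>v (mat_adjoint ?L *\<^sub>v (?L *\<^sub>v z))"
    by (simp add: minus_mult_mat_vec Rx)
  also have "\<dots> = P *\<^sub>v (z - mat_adjoint ?L *\<^sub>v (?L *\<^sub>v z))"
    by (rule mult_minus_distrib_mat_vec[of _ n n, symmetric]) (auto intro: carrier_matI carrier_vecI)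
  finally have "l2_norm_vec ((R - U * S * V) *\<^sub>v x) = l2_norm_vec (z - mat_adjoint ?L *\<^sub>v (?L *\<^sub>v z))"
    by (simp add: l2_norm_vec_unitary[OF svd_unitary(1)] carrier_vecI)
  moreover have "(mat_adjoint ?L *\<^sub>v (?L *\<^sub>v z)) $ i = (if i < r then z $ i else 0)" if "i < n" for i
  proof -
    have Lz: "(?L *\<^sub>v z) $ k = z $ k" if "k < r" for k
      using that r by (simp add: row_selector_def scalar_prod_def pick_lessThan
          if_distrib[of "\<lambda>x. x * _"] cong: if_cong)
    have Lidx: "?L $$ (k, i) = (if k = i then 1 else 0)" if "k < r" for k
      using that \<open>i < n\<close> by (simp add: row_selector_def pick_lessThan)
    have "(mat_adjoint ?L *\<^sub>v (?L *\<^sub>v z)) $ i = (\<Sum>k<r. mat_adjoint ?L $$ (i, k) * (?L *\<^sub>v z) $ k)"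
      using that by (simp add: scalar_prod_def lessThan_atLeast0 del: index_mult_mat_vec) (simp add: scalar_prod_def)
    also have "\<dots> = (\<Sum>k<r. if k = i then z $ i else 0)"
      using that by (intro sum.cong) (auto simp: Lz Lidx simp del: index_mult_mat_vec)
    finally show ?thesis by simp
  qed
  ultimately have "(l2_norm_vec ((R - U * S * V) *\<^sub>v x))\<^sup>2 = (\<Sum>i<n. (cmod (z $ i - (if i < r then z $ i else 0)))\<^sup>2)"
    by (simp add: l2_norm_vec_power2 del: index_mult_mat_vec)
  \<comment> \<open>Coordinates of \<open>z\<close> with index at least \<open>m\<close> are zero,
    as the diagonal matrix is rectangular; \<open>c\<close> bounds the singular values in the
    remaining truncated positions.\<close>
  also have "\<dots> \<le> (\<Sum>i<n. if i < m then c\<^sup>2 * (cmod (y $ i))\<^sup>2 else 0)"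
  proof (rule sum_mono)
    fix i assume i: "i \<in> {..<n}"
    have "(singular_value R (i + 1))\<^sup>2 \<le> c\<^sup>2" if "r \<le> i" "i < m"
      using that i c(2)[of i] singular_value_nonneg[of i R] by (intro power_mono) auto
    then show "(cmod (z $ i - (if i < r then z $ i else 0)))\<^sup>2 \<le> (if i < m then c\<^sup>2 * (cmod (y $ i))\<^sup>2 else 0)"
      using i by (auto simp: z_def index_singular_value_mat_mult_vec norm_mult power_mult_distrib
          intro!: mult_right_mono simp del: index_mult_mat_vec)
  qed
  also have "\<dots> = (\<Sum>i\<in>{..<n} \<inter> {..<m}. c\<^sup>2 * (cmod (y $ i))\<^sup>2)"
    by (subst sum.inter_restrict) auto
  also have "\<dots> \<le> (\<Sum>i<m. c\<^sup>2 * (cmod (y $ i))\<^sup>2)"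
    by (rule sum_mono2) auto
  also have "\<dots> = (c * l2_norm_vec y)\<^sup>2"
    by (simp add: power_mult_distrib l2_norm_vec_power2 sum_distrib_left)
  also have "l2_norm_vec y = l2_norm_vec x"
    unfolding y_def by (rule l2_norm_vec_unitary[OF svd_unitary(2) x])
  finally have sq: "(l2_norm_vec ((R - U * S * V) *\<^sub>v x))\<^sup>2 \<le> (c * l2_norm_vec x)\<^sup>2" .
  show ?thesis
    by (rule power2_le_imp_le[OF sq]) (use c(1) in simp)
qed

end

text \<open>One half of the Eckart-Young theorem: some nonzero vector in the span of the
  \<open>r + 1\<close> leading right singular vectors is killed by \<open>Y\<close>. There the error
  equals \<open>R\<close>, which stretches that span by at least its singular value of index
  \<open>r + 1\<close>.\<close>

lemma singular_value_le_low_rank_error: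
  assumes r: "r < n" "r < m" and X: "X \<in> carrier_mat n r" and Y: "Y \<in> carrier_mat r m"
    and err: "\<And>x. x \<in> carrier_vec m \<Longrightarrow> l2_norm_vec ((R - X * Y) *\<^sub>v x) \<le> c * l2_norm_vec x"
  shows "singular_value R (r + 1) \<le> c"
proof -
  have [simp]: "dim_row X = n" "dim_col X = r" "dim_row Y = r" "dim_col Y = m" using X Y by auto
  \<comment> \<open>\<open>F\<close> is \<open>Y\<close> restricted to the leading right singular
    vectors, which are the first \<open>r + 1\<close> columns of the adjoint of
    \<open>Q\<close>.\<close>
  define F where "F = mat r (Suc r) (\<lambda>(i, j). (Y * mat_adjoint Q) $$ (i, j))"
  obtain k where k: "k \<in> carrier_vec (Suc r)" "k \<noteq> 0\<^sub>v (Suc r)" "F *\<^sub>v k = 0\<^sub>v r"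
    by (rule wide_mat_kernel[of F r]) (auto simp: F_def)
  define y where "y = vec m (\<lambda>i. if i < Suc r then k $ i else 0)"
  define x where "x = mat_adjoint Q *\<^sub>v y"
  define s where "s = singular_value R (r + 1)"
  have [simp]: "dim_vec y = m" "dim_vec x = m" "dim_vec k = Suc r" using k(1) by (auto simp: y_def x_def)
  have ny: "(l2_norm_vec y)\<^sup>2 = (\<Sum>i<Suc r. (cmod (k $ i))\<^sup>2)"
  proof -
    have "(l2_norm_vec y)\<^sup>2 = (\<Sum>i<m. if i < Suc r then (cmod (k $ i))\<^sup>2 else 0)"
      unfolding l2_norm_vec_power2 by (intro sum.cong) (auto simp: y_def)
    also have "\<dots> = (\<Sum>i<Suc r. (cmod (k $ i))\<^sup>2)"
      using r by (intro sum.mono_neutral_cong_right) auto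
    finally show ?thesis .
  qed
  have "l2_norm_vec k \<noteq> 0" using k by (simp add: l2_norm_vec_eq_0_iff)
  moreover have "(l2_norm_vec k)\<^sup>2 = (l2_norm_vec y)\<^sup>2" unfolding ny by (simp add: l2_norm_vec_power2)
  ultimately have pos: "0 < l2_norm_vec y"
    by (metis l2_norm_vec_nonneg less_eq_real_def zero_power2 power2_eq_iff_nonneg)
  have "(Y * mat_adjoint Q) *\<^sub>v y = 0\<^sub>v r"
  proof (rule eq_vecI)
    fix i assume "i < dim_vec (0\<^sub>v r :: complex vec)"
    then have i: "i < r" by simp
    have "((Y * mat_adjoint Q) *\<^sub>v y) $ i = (\<Sum>j<m. (Y * mat_adjoint Q) $$ (i, j) * y $ j)"
      using i by (simp add: scalar_prod_def lessThan_atLeast0)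
    also have "\<dots> = (\<Sum>j<Suc r. (Y * mat_adjoint Q) $$ (i, j) * k $ j)"
      using r by (intro sum.mono_neutral_cong_right) (auto simp: y_def)
    also have "\<dots> = (F *\<^sub>v k) $ i"
      using i by (simp add: F_def scalar_prod_def lessThan_atLeast0)
    finally show "((Y * mat_adjoint Q) *\<^sub>v y) $ i = 0\<^sub>v r $ i" by (simp add: k(3))
  qed simp
  then have Yx: "Y *\<^sub>v x = 0\<^sub>v r"
    by (simp add: x_def mult_mat_vec_assoc)
  have "X *\<^sub>v 0\<^sub>v r = 0\<^sub>v n" by (rule eq_vecI) (auto simp: scalar_prod_def)
  then have "(R - X * Y) *\<^sub>v x = R *\<^sub>v x"
    by (simp add: minus_mult_mat_vec mult_mat_vec_assoc Yx) (rule eq_vecI, auto)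
  also have "\<dots> = P *\<^sub>v (singular_value_mat n m R *\<^sub>v (Q *\<^sub>v x))"
    by (subst svd_eq) (simp add: mult_mat_vec_assoc)
  also have "Q *\<^sub>v x = y"
    using svd_unitary(2) by (simp add: x_def mult_mat_vec_assoc[symmetric] unitary_mat_def carrier_vecI)
  finally have Rx: "l2_norm_vec ((R - X * Y) *\<^sub>v x) = l2_norm_vec (singular_value_mat n m R *\<^sub>v y)"
    by (simp add: l2_norm_vec_unitary[OF svd_unitary(1)] carrier_vecI)
  have s0: "0 \<le> s" using singular_value_nonneg[of r R] r by (simp add: s_def)
  have "(s * l2_norm_vec y)\<^sup>2 = (\<Sum>i<Suc r. s\<^sup>2 * (cmod (k $ i))\<^sup>2)"
    by (simp add: power_mult_distrib ny sum_distrib_left del: sum.lessThan_Suc)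
  also have "\<dots> \<le> (\<Sum>i<Suc r. (cmod ((singular_value_mat n m R *\<^sub>v y) $ i))\<^sup>2)"
  proof (rule sum_mono)
    fix i assume i: "i \<in> {..<Suc r}"
    then have "s\<^sup>2 \<le> (singular_value R (i + 1))\<^sup>2"
      using r s0 singular_value_antimono[of i r R] by (intro power_mono) (auto simp: s_def)
    then show "s\<^sup>2 * (cmod (k $ i))\<^sup>2 \<le> (cmod ((singular_value_mat n m R *\<^sub>v y) $ i))\<^sup>2"
      using i r by (auto simp: index_singular_value_mat_mult_vec y_def norm_mult power_mult_distrib
          intro!: mult_right_mono simp del: index_mult_mat_vec)
  qed
  also have "\<dots> \<le> (\<Sum>i<n. (cmod ((singular_value_mat n m R *\<^sub>v y) $ i))\<^sup>2)"
    using r by (intro sum_mono2) auto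
  also have "\<dots> = (l2_norm_vec ((R - X * Y) *\<^sub>v x))\<^sup>2"
    by (simp add: Rx l2_norm_vec_power2 del: index_mult_mat_vec)
  finally have "s * l2_norm_vec y \<le> l2_norm_vec ((R - X * Y) *\<^sub>v x)"
    by (rule power2_le_imp_le) simp
  also have "\<dots> \<le> c * l2_norm_vec x" by (rule err) (simp add: carrier_vecI)
  also have "l2_norm_vec x = l2_norm_vec y"
    unfolding x_def by (rule l2_norm_vec_unitary[OF svd_unitary(2)]) (simp add: carrier_vecI)
  finally show ?thesis using pos by (simp add: s_def)
qed

end

section \<open>The error bound\<close>

text \<open>Origin of the two factors of the final bound:
  \<open>1 + r / (n + 1 - r) = (n + 1) / (n + 1 - r)\<close>.\<close>

lemma sqrt_one_plus_le:
  assumes "0 \<le> t" "t \<le> sqrt (real r / (real n + 1 - real r))" "r \<le> n"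
  shows "sqrt (1 + t\<^sup>2) \<le> sqrt ((real n + 1) / (real n + 1 - real r))"
proof -
  have "t\<^sup>2 \<le> (sqrt (real r / (real n + 1 - real r)))\<^sup>2" using assms by (intro power_mono) auto
  also have "\<dots> = real r / (real n + 1 - real r)" using assms(3) by simp
  also have "1 + \<dots> = (real n + 1) / (real n + 1 - real r)" using assms(3) by (simp add: field_simps)
  finally show ?thesis by simp
qed

lemma dominant_basis_cols_interpolation:
  assumes dom: "dominant_basis_cols V m J"
  obtains G where "G \<in> carrier_mat m (dim_col V)" "cols_submatrix V J * G = V"
    "\<And>l. l < m \<Longrightarrow> col G (pick J l) = unit_vec m l"
    "\<And>j. j < dim_col V \<Longrightarrow> j \<notin> J \<Longrightarrow> l2_norm_vec (col G j) \<le> sqrt (real (dim_row V) / (real m + 1 - real (dim_row V)))"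
proof -
  have J: "J \<subseteq> {..<dim_col V}" "card J = m"
    using dom by (auto simp: dominant_basis_cols_def dominant_basis_rows_def)
  from dom obtain T where T: "T \<in> carrier_mat (dim_col V) m" "T * rows_submatrix (transpose_mat V) J = transpose_mat V"
    "\<And>l. l < m \<Longrightarrow> row T (pick J l) = unit_vec m l"
    "\<And>j. j < dim_col V \<Longrightarrow> j \<notin> J \<Longrightarrow> l2_norm_vec (row T j) \<le> sqrt (real (dim_row V) / (real m + 1 - real (dim_row V)))"
    unfolding dominant_basis_cols_def by (rule dominant_basis_rows_interpolation) (simp add: that)
  have "rows_submatrix (transpose_mat V) J \<in> carrier_mat m (dim_row V)"
    using J by (intro carrier_matI) (simp_all add: rows_submatrix_eq_mult)
  from transpose_mult[OF T(1) this] have "cols_submatrix V J * transpose_mat T = V"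
    by (simp add: T(2) transpose_rows_submatrix_transpose)
  then show ?thesis
    using T J by (intro that[of "transpose_mat T"]) (auto simp: pick_less)
qed

lemma pick_surj:
  assumes "I \<subseteq> {..<n}" "i \<in> I"
  obtains l where "l < card I" "pick I l = i"
  using bij_betw_pick[of I] assms finite_subset[of I "{..<n}"]
  by (metis bij_betw_imp_surj_on finite_lessThan imageE lessThan_iff)

lemma dominant_cgr_approximant_carrier:
  assumes "dominant_cgr_approximant r n m A Z At"
  shows "At \<in> carrier_mat (dim_row A) (dim_col A)"
  using assms
  by (auto simp: dominant_cgr_approximant_def rows_submatrix_def cols_submatrix_def dim_submatrix
      intro!: carrier_matI)

text \<open>The witness \<gamma> is the sum of the norms of row \<open>i\<close> of \<open>T\<close>
  and of \<open>1 - T L\<close>. Strictness is stated for \<gamma>, because the factor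
  \<open>singular_value A (r + 1)\<close> may be zero; multiplying by it later yields both forms of
  the theorem.\<close>

lemma dominant_cgr_entry_bound:
  assumes K: "K = UNIV \<or> K = \<real>"
    and A: "A \<in> carrier_mat N M" "elements_mat A \<subseteq> K"
    and r: "r \<le> n" "r \<le> m" "r < M"
    and best: "best_rank_approx K r A Z"
    and cgr: "dominant_cgr_approximant r n m A Z At"
    and ij: "i < N" "j < M"
  obtains \<gamma> where "\<gamma> < 2 * sqrt ((real n + 1) / (real n + 1 - real r))"
    "cmod ((A - At) $$ (i, j)) \<le> \<gamma> * (sqrt ((real m + 1) / (real m + 1 - real r)) * singular_value A (r + 1))"
proof -
  define \<sigma> where "\<sigma> = singular_value A (r + 1)"
  have dimA [simp]: "dim_row A = N" "dim_col A = M" using A by auto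
  obtain ZU ZV I R P Q U S V J W C where
    ZU: "ZU \<in> carrier_mat N r" and ZV: "ZV \<in> carrier_mat r M" and Z: "Z = ZU * ZV"
    and I: "dominant_basis_rows ZU n I" and R: "R = rows_submatrix A I" and svd: "is_svd R P Q"
    and U: "U = cols_submatrix P {..<r}" and S: "S = singular_value_mat r r R" and V: "V = rows_submatrix Q {..<r}"
    and J: "dominant_basis_cols V m J" and W: "W = cols_submatrix V J" and C: "C = cols_submatrix A J"
    and At: "At = C * pseudo_inverse (U * S * W) * R"
    using cgr unfolding dominant_cgr_approximant_def dimA by metis
  have dimZ [simp]: "dim_row ZU = N" "dim_col ZU = r" "dim_row ZV = r" "dim_col ZV = M"
    "dim_row Z = N" "dim_col Z = M"
    using ZU ZV by (auto simp: Z)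
  have Isub: "I \<subseteq> {..<N}" "card I = n" using I by (auto simp: dominant_basis_rows_def)
  define L where "L = row_selector N I"
  have dimL [simp]: "dim_row L = n" "dim_col L = N" by (simp_all add: L_def Isub)
  have R_eq: "R = L * A" using Isub by (simp add: R L_def rows_submatrix_eq_mult)
  have ZUI: "rows_submatrix ZU I = L * ZU" using Isub by (simp add: L_def rows_submatrix_eq_mult)
  have Rc: "R \<in> carrier_mat n M" by (rule carrier_matI) (simp_all add: R_eq)
  note dims_svd [simp] = svd_dims[OF svd Rc]
  have rM: "r \<le> M" using r by simp
  have dimUSV [simp]: "dim_row U = n" "dim_col U = r" "dim_row S = r" "dim_col S = r" "dim_row V = r" "dim_col V = M"
    by (auto simp: svd_left_eq[OF svd Rc r(1) rM U S V] svd_right_eq[OF svd Rc r(1) rM U S V] S)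
  have Jsub: "J \<subseteq> {..<M}" "card J = m" using J by (auto simp: dominant_basis_cols_def dominant_basis_rows_def)
  define H where "H = mat_adjoint (row_selector M J)"
  have dimH [simp]: "dim_row H = M" "dim_col H = m" by (simp_all add: H_def Jsub)
  have W_eq: "W = V * H" and C_eq: "C = A * H"
    using Jsub by (simp_all add: W C H_def cols_submatrix_eq_mult)
  have dimW [simp]: "dim_row W = r" "dim_col W = m" by (simp_all add: W_eq)

  obtain T where Tc: "T \<in> carrier_mat N n" and T: "T * (L * ZU) = ZU"
    and T_in: "\<And>l. l < n \<Longrightarrow> row T (pick I l) = unit_vec n l"
    and T_out: "\<And>i. i < N \<Longrightarrow> i \<notin> I \<Longrightarrow> l2_norm_vec (row T i) \<le> sqrt (real r / (real n + 1 - real r))"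
    using I by (rule dominant_basis_rows_interpolation) (simp add: that ZUI)
  have [simp]: "dim_row T = N" "dim_col T = n" using Tc by auto
  obtain G0 where G0c: "G0 \<in> carrier_mat m M" and G0: "W * G0 = V"
    and G0_in: "\<And>l. l < m \<Longrightarrow> col G0 (pick J l) = unit_vec m l"
    and G0_out: "\<And>j. j < M \<Longrightarrow> j \<notin> J \<Longrightarrow> l2_norm_vec (col G0 j) \<le> sqrt (real r / (real m + 1 - real r))"
    using J by (rule dominant_basis_cols_interpolation) (simp add: that W)
  have [simp]: "dim_row G0 = m" "dim_col G0 = M" using G0c by auto

  \<comment> \<open>The pseudo-inverse reproduces the main part of \<open>R\<close>\<close>
  define B where "B = U * (S * W)"
  define X where "X = pseudo_inverse B"
  define B' where "B' = U * (S * V)"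
  define G where "G = X * R"
  have dimB [simp]: "dim_row B = n" "dim_col B = m" "dim_row B' = n" "dim_col B' = M"
    by (simp_all add: B_def B'_def)
  have "is_pseudo_inverse B X" unfolding X_def by (rule is_pseudo_inverse_pseudo_inverse)
  then have dimX [simp]: "dim_row X = m" "dim_col X = n"
    and pinv: "B * (X * B) = B" "X * (B * X) = X" "mat_adjoint (B * X) = B * X" "mat_adjoint (X * B) = X * B"
    by (auto simp: is_pseudo_inverse_def mult_mat_assoc)
  have dimG [simp]: "dim_row G = m" "dim_col G = M" by (simp_all add: G_def R_eq)
  \<comment> \<open>\<open>G0\<close> solves the same equation as \<open>G\<close> and carries the
    norm bound from dominance; \<open>G\<close> is what the approximant actually contains.\<close>
  have BG0: "B * G0 = B'" by (simp add: B_def B'_def mult_mat_assoc G0)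
  \<comment> \<open>The truncated part \<open>R - B'\<close> is orthogonal to the columns of
    \<open>U\<close>, hence to those of \<open>B\<close>.\<close>
  have UB': "mat_adjoint U * B' = mat_adjoint U * R"
    by (simp add: B'_def mult_mat_assoc[symmetric] svd_left_isometry[OF svd Rc r(1) rM U S V]
        svd_left_adjoint[OF svd Rc r(1) rM U S V])
  have BR: "mat_adjoint B * R = mat_adjoint B * B'"
    by (simp add: B_def mat_adjoint_mult mult_mat_assoc UB')
  \<comment> \<open>\<open>B X\<close> projects onto the range of \<open>B\<close>, which contains that of \<open>B'\<close> and is orthogonal to that of
    \<open>R - B'\<close>. This does not need \<open>S\<close> to be invertible.\<close>
  have BG: "B * G = B'"
  proof -
    have "B * G = mat_adjoint (B * X) * R" by (simp add: G_def pinv(3) mult_mat_assoc)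
    also have "\<dots> = mat_adjoint X * (mat_adjoint B * B')" by (simp add: mat_adjoint_mult mult_mat_assoc BR)
    also have "\<dots> = mat_adjoint (B * X) * (B * G0)" by (simp add: mat_adjoint_mult mult_mat_assoc BG0)
    also have "\<dots> = (B * (X * B)) * G0" unfolding pinv(3) by (simp add: mult_mat_assoc)
    finally show ?thesis by (simp add: pinv(1) BG0)
  qed

  \<comment> \<open>Decomposition of the error\<close>
  define E where "E = R - U * S * V"
  define E0 where "E0 = A - Z"
  define \<Omega> where "\<Omega> = 1\<^sub>m M - H * G"
  define \<Lambda> where "\<Lambda> = 1\<^sub>m N - T * L"
  have dimE [simp]: "dim_row E = n" "dim_col E = M" "dim_row E0 = N" "dim_col E0 = M"
    "dim_row \<Omega> = M" "dim_col \<Omega> = M" "dim_row \<Lambda> = N" "dim_col \<Lambda> = N"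
    by (simp_all add: E_def E0_def \<Omega>_def \<Lambda>_def)
  have At_eq: "At = A * (H * G)"
  proof -
    have "At = C * X * R" by (simp add: At X_def B_def mult_mat_assoc)
    then show ?thesis by (simp add: C_eq G_def R_eq mult_mat_assoc)
  qed
  have dimAt: "dim_row At = N" "dim_col At = M" by (simp_all add: At_eq)
  have A\<Omega>: "A * \<Omega> = A - At"
    by (simp add: \<Omega>_def mult_minus_mat At_eq right_mult_one_mat[OF A(1)])
  have \<Lambda>E0: "\<Lambda> * E0 = A - T * R"
  proof -
    have \<Lambda>: "\<Lambda> * Y = Y - T * (L * Y)" if "dim_row Y = N" for Y
      using that by (simp add: \<Lambda>_def minus_mult_mat mult_mat_assoc left_mult_one_mat[OF carrier_matI])
    \<comment> \<open>\<open>T\<close> rebuilds \<open>ZU\<close> from its basis rows, hence also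
      \<open>Z\<close>; so \<Lambda> annihilates \<open>Z\<close>.\<close>
    have "T * (L * Z) = (T * (L * ZU)) * ZV" by (simp add: Z mult_mat_assoc)
    then have "\<Lambda> * Z = Z - Z" by (simp add: \<Lambda> T Z)
    then show ?thesis
      by (simp add: E0_def mult_minus_mat \<Lambda> R_eq) (rule eq_matI, simp_all add: R_eq[symmetric])
  qed
  have E\<Omega>: "E * \<Omega> = R * \<Omega>"
  proof -
    \<comment> \<open>Taking the selected columns of \<open>B'\<close> gives \<open>B\<close>, so
      \<open>BG\<close> shows that the main part annihilates \<Omega>.\<close>
    have "B' * (H * G) = B * G" by (simp add: B_def B'_def W_eq mult_mat_assoc)
    then have "B' * \<Omega> = B' - B'"
      by (simp add: \<Omega>_def mult_minus_mat BG right_mult_one_mat[OF carrier_matI])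
    then show ?thesis
      unfolding E_def by (subst minus_mult_mat) (simp_all add: B'_def[symmetric] mult_mat_assoc R_eq, rule eq_matI, simp_all)
  qed
  have decomp: "A - At = T * (E * \<Omega>) + \<Lambda> * (E0 * \<Omega>)"
  proof -
    have "\<Lambda> * (E0 * \<Omega>) = A * \<Omega> - T * (R * \<Omega>)"
      by (simp add: mult_mat_assoc[symmetric] \<Lambda>E0 minus_mult_mat R_eq)
    then show ?thesis
      by (simp add: A\<Omega> E\<Omega> dimAt) (rule eq_matI, simp_all add: R_eq[symmetric] dimAt del: index_mult_mat(1))
  qed

  \<comment> \<open>Operator norm bounds for \<open>E0\<close> and \<open>E\<close>\<close>
  have \<sigma>: "0 \<le> \<sigma>" using singular_value_nonneg[of r A] r by (simp add: \<sigma>_def)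
  have E0_le: "l2_norm_vec (E0 *\<^sub>v x) \<le> \<sigma> * l2_norm_vec x" if "dim_vec x = M" for x
    unfolding E0_def \<sigma>_def
    by (rule best_rank_approx_error[OF K A r(3) best carrier_vecI[OF that]])
  \<comment> \<open>For \<open>r = n\<close> there is no such index. Otherwise \<open>L Z\<close>
    factors through dimension \<open>r\<close>, and its error \<open>L E0\<close> is no larger than
    \<open>E0\<close>, since dropping rows cannot increase a norm.\<close>
  have svR: "singular_value R (i + 1) \<le> \<sigma>" if "r \<le> i" "i < n" "i < M" for i
  proof -
    have "singular_value R (i + 1) \<le> singular_value R (r + 1)"
      using that by (intro singular_value_antimono) simp_all
    also have "\<dots> \<le> \<sigma>"
    proof (rule singular_value_le_low_rank_error[OF svd Rc _ r(3) carrier_matI ZV])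
      fix x :: "complex vec" assume "x \<in> carrier_vec M"
      then have x: "dim_vec x = M" by simp
      have "R - (L * ZU) * ZV = L * E0"
        by (simp add: E0_def mult_minus_mat R_eq Z mult_mat_assoc)
      then have "l2_norm_vec ((R - (L * ZU) * ZV) *\<^sub>v x) = l2_norm_vec (L *\<^sub>v (E0 *\<^sub>v x))"
        using x by (simp add: mult_mat_vec_assoc)
      also have "\<dots> \<le> l2_norm_vec (E0 *\<^sub>v x)"
        unfolding L_def using Isub by (intro l2_norm_vec_row_selector_le) auto
      also have "\<dots> \<le> \<sigma> * l2_norm_vec x" by (rule E0_le[OF x])
      finally show "l2_norm_vec ((R - (L * ZU) * ZV) *\<^sub>v x) \<le> \<sigma> * l2_norm_vec x" .
    qed (use that in simp_all)
    finally show ?thesis .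
  qed
  have E_le: "l2_norm_vec (E *\<^sub>v x) \<le> \<sigma> * l2_norm_vec x" if "dim_vec x = M" for x
    unfolding E_def
    by (rule svd_truncation_error[OF svd Rc r(1) rM U S V \<sigma> svR carrier_vecI[OF that]])

  \<comment> \<open>Column \<open>j\<close> of \<Omega>\<close>
  define b where "b = sqrt ((real m + 1) / (real m + 1 - real r))"
  define w where "w = col \<Omega> j"
  define g where "g = col G j"
  have dimw [simp]: "dim_vec w = M" "dim_vec g = m" by (simp_all add: w_def g_def)
  have w_eq: "w = unit_vec M j - H *\<^sub>v g"
    unfolding w_def \<Omega>_def g_def using ij by (simp add: col_mult_mat[symmetric]) (rule eq_vecI, simp_all)
  \<comment> \<open>\<open>X B\<close> is the orthogonal projection onto the row space of
    \<open>B\<close>. So \<open>G\<close> is the projection of \<open>G0\<close>, and its columns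
    inherit the bound.\<close>
  have "G = X * (B * G)"
    by (simp add: G_def mult_mat_assoc[symmetric]) (simp add: mult_mat_assoc pinv(2))
  also have "\<dots> = (X * B) * G0" unfolding BG BG0[symmetric] by (simp add: mult_mat_assoc)
  finally have g_eq: "g = (X * B) *\<^sub>v col G0 j"
    unfolding g_def using ij by (simp add: col_mult_mat)
  have XB: "X * B \<in> carrier_mat m m" "X * B * (X * B) = X * B"
    by (auto simp: mult_mat_assoc pinv(1) intro: carrier_matI)
  \<comment> \<open>Unlike \<open>T\<close>, the matrix \<open>G\<close> is dictated by the
    approximant, so a selected column of \<Omega> need not vanish. It is a complementary projection
    of a unit vector, of norm at most 1, and \<open>b\<close> is at least 1.\<close>
  have w_le: "l2_norm_vec w \<le> b"
  proof (cases "j \<in> J")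
    case True
    then obtain l where l: "l < m" "pick J l = j" using pick_surj[OF Jsub(1)] Jsub(2) by metis
    have "l2_norm_vec w = l2_norm_vec (unit_vec m l - (X * B) *\<^sub>v unit_vec m l)"
      using l2_norm_interpolation_inside[OF Jsub(1), of l g] l Jsub(2) G0_in[OF l(1)]
      by (simp add: w_eq H_def g_eq)
    also have "\<dots> \<le> l2_norm_vec (unit_vec m l)"
      by (rule l2_norm_vec_coprojection_le[OF XB(1) pinv(4) XB(2)]) simp
    also have "\<dots> \<le> b" using l r(2) by (simp add: l2_norm_unit_vec b_def)
    finally show ?thesis .
  next
    case False
    have "l2_norm_vec g \<le> l2_norm_vec (col G0 j)"
      unfolding g_eq by (rule l2_norm_vec_projection_le[OF XB(1) pinv(4) XB(2)]) (simp add: carrier_vecI)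
    also have "\<dots> \<le> sqrt (real r / (real m + 1 - real r))" using False ij G0_out by simp
    finally have "sqrt (1 + (l2_norm_vec g)\<^sup>2) \<le> b"
      unfolding b_def using r(2) by (intro sqrt_one_plus_le) auto
    then show ?thesis
      using l2_norm_interpolation_outside[OF Jsub(1), of j g] False ij Jsub(2) by (simp add: w_eq H_def)
  qed

  \<comment> \<open>Row \<open>i\<close> of \<open>T\<close> and of \<Lambda>\<close>
  define t where "t = row T i"
  define u where "u = row \<Lambda> i"
  have dimt [simp]: "dim_vec t = n" "dim_vec u = N" by (simp_all add: t_def u_def)
  \<comment> \<open>A row of \<open>T L\<close> is the transpose of \<open>L\<close> applied to a
    row of \<open>T\<close>; as \<open>L\<close> is real, its adjoint serves as the
    transpose.\<close>
  have u_eq: "u = unit_vec N i - mat_adjoint L *\<^sub>v t"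
  proof (rule eq_vecI)
    fix k assume "k < dim_vec (unit_vec N i - mat_adjoint L *\<^sub>v t)"
    then have k: "k < N" by simp
    have "row T i \<bullet> col L k = col L k \<bullet> row T i"
      by (rule comm_scalar_prod[of _ n]) (auto intro: carrier_vecI)
    then show "u $ k = (unit_vec N i - mat_adjoint L *\<^sub>v t) $ k"
      using ij k by (auto simp: u_def \<Lambda>_def t_def L_def transpose_row_selector[symmetric])
  qed simp
  define a where "a = sqrt ((real n + 1) / (real n + 1 - real r))"
  \<comment> \<open>Source of the strict inequality. On basis rows the sum is 1, while
    \<open>a\<close> is at least 1; elsewhere \<open>r < n + 1\<close> makes the bound on
    \<open>t\<close> strictly smaller than \<open>a\<close>.\<close>
  have tu: "l2_norm_vec t + l2_norm_vec u < 2 * a"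
  proof (cases "i \<in> I")
    case True
    then obtain l where l: "l < n" "pick I l = i" using pick_surj[OF Isub(1)] Isub(2) by metis
    have t: "t = unit_vec n l" unfolding t_def l(2)[symmetric] by (rule T_in[OF l(1)])
    have "l2_norm_vec u = l2_norm_vec (unit_vec n l - t)"
      using l2_norm_interpolation_inside[OF Isub(1), of l t] l Isub(2) by (simp add: u_eq L_def)
    also have "\<dots> = 0" by (simp add: t l2_norm_vec_eq_0_iff)
    finally have "l2_norm_vec u = 0" .
    moreover have "1 \<le> a" using r(1) by (simp add: a_def)
    ultimately show ?thesis by (simp add: t l2_norm_unit_vec[OF l(1)])
  next
    case False
    have t: "l2_norm_vec t \<le> sqrt (real r / (real n + 1 - real r))"
      unfolding t_def using False ij T_out by simp
    also have "\<dots> < a" unfolding a_def using r(1) by (simp add: divide_strict_right_mono)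
    finally have "l2_norm_vec t < a" .
    moreover have "sqrt (1 + (l2_norm_vec t)\<^sup>2) \<le> a"
      unfolding a_def using t r(1) by (intro sqrt_one_plus_le) auto
    then have "l2_norm_vec u \<le> a"
      using l2_norm_interpolation_outside[OF Isub(1), of i t] False ij Isub(2) by (simp add: u_eq L_def)
    ultimately show ?thesis by simp
  qed

  have "(A - At) $$ (i, j) = t \<bullet> (E *\<^sub>v w) + u \<bullet> (E0 *\<^sub>v w)"
    unfolding decomp t_def u_def w_def using ij by (simp add: col_mult_mat)
  then have "cmod ((A - At) $$ (i, j)) \<le> cmod (t \<bullet> (E *\<^sub>v w)) + cmod (u \<bullet> (E0 *\<^sub>v w))"
    by (simp only: norm_triangle_ineq)
  also have "\<dots> \<le> l2_norm_vec t * l2_norm_vec (E *\<^sub>v w) + l2_norm_vec u * l2_norm_vec (E0 *\<^sub>v w)"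
    by (intro add_mono cmod_scalar_prod_le) simp_all
  also have "\<dots> \<le> l2_norm_vec t * (\<sigma> * l2_norm_vec w) + l2_norm_vec u * (\<sigma> * l2_norm_vec w)"
    by (intro add_mono mult_left_mono E_le E0_le) simp_all
  also have "\<dots> = (l2_norm_vec t + l2_norm_vec u) * (l2_norm_vec w * \<sigma>)"
    by (simp add: algebra_simps)
  also have "\<dots> \<le> (l2_norm_vec t + l2_norm_vec u) * (b * \<sigma>)"
    by (intro mult_left_mono mult_right_mono w_le \<sigma>) (simp add: add_nonneg_nonneg)
  finally show ?thesis
    using that tu unfolding a_def b_def \<sigma>_def by blast
qed

text \<open>If \<open>singular_value A (r + 1)\<close> is zero, the right-hand side is zero and no
  norm lies strictly below it; strictness is therefore asserted for a positive singular
  value.\<close>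

theorem theorem4p8:
  fixes A Z At :: "complex mat" and K :: "complex set" and N M r n m :: nat
  assumes "K = UNIV \<or> K = \<real>"
    and "A \<in> carrier_mat N M" and "elements_mat A \<subseteq> K"
    and "r \<le> n" and "n < N" and "r \<le> m" and "m < M"
    and "best_rank_approx K r A Z"
    and "dominant_cgr_approximant r n m A Z At"
  shows "chebyshev_norm (A - At)
           \<le> 2 * sqrt ((real n + 1) * (real m + 1) / ((real n + 1 - real r) * (real m + 1 - real r)))
               * singular_value A (r + 1) \<and>
         (singular_value A (r + 1) > 0 \<longrightarrow>
          chebyshev_norm (A - At)
           < 2 * sqrt ((real n + 1) * (real m + 1) / ((real n + 1 - real r) * (real m + 1 - real r)))
               * singular_value A (r + 1))"
proof -
  define a where "a = sqrt ((real n + 1) / (real n + 1 - real r))"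
  define b where "b = sqrt ((real m + 1) / (real m + 1 - real r))"
  define s where "s = singular_value A (r + 1)"
  have ab: "sqrt ((real n + 1) * (real m + 1) / ((real n + 1 - real r) * (real m + 1 - real r))) = a * b"
    by (simp add: a_def b_def flip: real_sqrt_mult)
  have rM: "r < M" using assms by simp
  have s: "0 \<le> s" using singular_value_nonneg[of r A] assms(2) rM by (simp add: s_def)
  have b: "0 < b" using assms by (simp add: b_def)
  note bound = dominant_cgr_entry_bound[OF assms(1-4,6) rM assms(8,9), folded a_def b_def s_def]
  have dims: "dim_row At = N" "dim_col At = M"
    using dominant_cgr_approximant_carrier[OF assms(9)] assms(2) by auto
  define X where "X = {cmod ((A - At) $$ (i, j)) |i j. i < dim_row (A - At) \<and> j < dim_col (A - At)}"
  have X_eq: "X = (\<lambda>(i, j). cmod ((A - At) $$ (i, j))) ` ({..<N} \<times> {..<M})"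
    unfolding X_def using dims by auto
  \<comment> \<open>\<open>n < N\<close> and \<open>m < M\<close> make both dimensions positive, so
    the maximum is attained and strict bounds on entries pass to it.\<close>
  have fin: "finite X" "X \<noteq> {}" using assms unfolding X_eq by auto
  have le: "x \<le> 2 * (a * b) * s" if x: "x \<in> X" for x
  proof -
    from x obtain i j where ij: "i < N" "j < M" and xeq: "x = cmod ((A - At) $$ (i, j))" unfolding X_eq by auto
    obtain \<gamma> where \<gamma>: "\<gamma> < 2 * a" "x \<le> \<gamma> * (b * s)" unfolding xeq using bound[OF ij] .
    note \<gamma>(2)
    also have "\<gamma> * (b * s) \<le> 2 * a * (b * s)" using \<gamma>(1) b s by (intro mult_right_mono) auto
    finally show ?thesis by (simp only: mult_ac)
  qed
  have less: "x < 2 * (a * b) * s" if x: "x \<in> X" and "0 < s" for x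
  proof -
    from x obtain i j where ij: "i < N" "j < M" and xeq: "x = cmod ((A - At) $$ (i, j))" unfolding X_eq by auto
    obtain \<gamma> where \<gamma>: "\<gamma> < 2 * a" "x \<le> \<gamma> * (b * s)" unfolding xeq using bound[OF ij] .
    note \<gamma>(2)
    also have "\<gamma> * (b * s) < 2 * a * (b * s)"
      using \<gamma>(1) b \<open>0 < s\<close> by (intro mult_strict_right_mono) auto
    finally show ?thesis by (simp only: mult_ac)
  qed
  have "chebyshev_norm (A - At) = Max X" by (simp add: chebyshev_norm_def X_def)
  then show ?thesis
    unfolding ab s_def[symmetric] using fin le less by simp
qed

end
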